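(* Let $\lambda>0$ and $\sigma\in\mathbb R$, and define $$\widetilde L_{\mathrm{tac}}^{\lambda,\sigma}(\tau_1,\xi_1,\tau_2,\xi_2)=(1+\sqrt{\lambda^{-1}})^{1/3}\int_{\widetilde\sigma}^\infty \Big[(\mathbf 1-\chi_{\widetilde\sigma}K_{\mathrm{Ai}}\chi_{\widetilde\sigma})^{-1}C^\lambda_{-\tau_1,\sigma+\xi_1}\Big](x)\; b^\lambda_{\tau_2,\sigma+\xi_2}(x)\,dx .$$ Then for all $\tau_1,\xi_1,\tau_2,\xi_2\in\mathbb R$ the kernel $\mathcal L_{\mathrm{tac}}^{\lambda,\sigma}$ defined in the context satisfies $$\mathcal L_{\mathrm{tac}}^{\lambda,\sigma}(\tau_1,\xi_1,\tau_2,\xi_2)=-\mathbf 1(\tau_1<\tau_2)\,p(\tau_2-\tau_1;\xi_1,\xi_2)+\widetilde L_{\mathrm{tac}}^{\lambda,\sigma}(\tau_1,\xi_1,\tau_2,\xi_2)+\lambda^{1/6}\,\widetilde L_{\mathrm{tac}}^{\lambda^{-1},\lambda^{2/3}\sigma}\big(\lambda^{1/3}\tau_1,-\lambda^{1/6}\xi_1,\lambda^{1/3}\tau_2,-\lambda^{1/6}\xi_2\big).$$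
   Context: Let $\mathrm{Ai}$ be the Airy function, $$\mathrm{Ai}^{(s)}(x)=e^{\frac23s^3+xs}\,\mathrm{Ai}(s^2+x),\qquad K_{\mathrm{Ai}}^{(\alpha,\beta)}(x,y)=\int_0^\infty \mathrm{Ai}^{(\alpha)}(x+u)\,\mathrm{Ai}^{(\beta)}(y+u)\,du,\qquad K_{\mathrm{Ai}}=K_{\mathrm{Ai}}^{(0,0)},$$ $$p(t;x,y)=\frac1{\sqrt{4\pi t}}\exp\Big(-\frac{(y-x)^2}{4t}\Big),$$ $$B^\lambda_{\tau,\xi}(x)=\int_0^\infty \mathrm{Ai}^{(\tau)}\big(\xi+(1+\sqrt{\lambda^{-1}})^{1/3}\mu\big)\,\mathrm{Ai}(x+\mu)\,d\mu,$$ $$b^\lambda_{\tau,\xi}(x)=\lambda^{1/6}\,\mathrm{Ai}^{(\lambda^{1/3}\tau)}\big(-\lambda^{1/6}\xi+(1+\sqrt\lambda)^{1/3}x\big),\qquad C^\lambda_{\tau,\xi}(x)=b^\lambda_{\tau,\xi}(x)-B^\lambda_{\tau,\xi}(x),$$ $$\widetilde\sigma=\lambda^{1/6}(1+\sqrt\lambda)^{2/3}\sigma,\qquad \chi_a(x)=\mathbf 1(x>a).$$ ($\widetilde\sigma$ is unchanged when $(\lambda,\sigma)$ is replaced by $(\lambda^{-1},\lambda^{2/3}\sigma)$.) $K_{\mathrm{Ai}}$ is identified with the corresponding integral operator, and $\mathbf 1-\chi_{\widetilde\sigma}K_{\mathrm{Ai}}\chi_{\widetilde\sigma}$ is inverted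 on $L^2((\widetilde\sigma,\infty))$. The kernel $\mathcal L_{\mathrm{tac}}^{\lambda,\sigma}$ is defined by $$L_{\mathrm{tac}}^{\lambda,\sigma}(\tau_1,\xi_1,\tau_2,\xi_2)=K_{\mathrm{Ai}}^{(-\tau_1,\tau_2)}(\sigma+\xi_1,\sigma+\xi_2)+(1+\sqrt{\lambda^{-1}})^{1/3}\Big\langle B^\lambda_{\tau_2,\sigma+\xi_2}-b^\lambda_{\tau_2,\sigma+\xi_2},\ (\mathbf 1-\chi_{\widetilde\sigma}K_{\mathrm{Ai}}\chi_{\widetilde\sigma})^{-1}B^\lambda_{-\tau_1,\sigma+\xi_1}\Big\rangle_{L^2((\widetilde\sigma,\infty))}$$ and $$\mathcal L_{\mathrm{tac}}^{\lambda,\sigma}(\tau_1,\xi_1,\tau_2,\xi_2)=-\mathbf 1(\tau_1<\tau_2)\,p(\tau_2-\tau_1;\xi_1,\xi_2)+L_{\mathrm{tac}}^{\lambda,\sigma}(\tau_1,\xi_1,\tau_2,\xi_2)+\lambda^{1/6}L_{\mathrm{tac}}^{\lambda^{-1},\lambda^{2/3}\sigma}\big(\lambda^{1/3}\tau_1,-\lambda^{1/6}\xi_1,\lambda^{1/3}\tau_2,-\lambda^{1/6}\xi_2\big).$$ *)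

theory Defs
  imports "HOL-Analysis.Analysis"
begin

text \<open>The Airy function on the real line.  The cosine integral converges only conditionally,
  so it is taken as an improper integral.\<close>

definition Airy :: "real \<Rightarrow> real" where
  "Airy x = (1 / pi) * Lim at_top (\<lambda>R. integral {0..R} (\<lambda>t. cos (t ^ 3 / 3 + x * t)))"

text \<open>The function written \<open>Ai\<close> with superscript \<open>(s)\<close>; the superscript is a real
  parameter and not an order of differentiation.\<close>

definition Airy_ext :: "real \<Rightarrow> real \<Rightarrow> real" where
  "Airy_ext s x = exp (2 / 3 * s ^ 3 + x * s) * Airy (s ^ 2 + x)"

definition K_Airy_ext :: "real \<Rightarrow> real \<Rightarrow> real \<Rightarrow> real \<Rightarrow> real" where
  "K_Airy_ext \<alpha> \<beta> x y = (LBINT u:{0<..}. Airy_ext \<alpha> (x + u) * Airy_ext \<beta> (y + u))"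

definition K_Airy :: "real \<Rightarrow> real \<Rightarrow> real" where
  "K_Airy = K_Airy_ext 0 0"

definition heat_kernel :: "real \<Rightarrow> real \<Rightarrow> real \<Rightarrow> real" where
  "heat_kernel t x y = 1 / sqrt (4 * pi * t) * exp (- ((y - x)^2) / (4 * t))"

definition B_fun :: "real \<Rightarrow> real \<Rightarrow> real \<Rightarrow> real \<Rightarrow> real" where
  "B_fun l \<tau> \<xi> x =
     (LBINT \<mu>:{0<..}. Airy_ext \<tau> (\<xi> + (1 + sqrt (1 / l)) powr (1/3) * \<mu>) * Airy (x + \<mu>))"

definition b_fun :: "real \<Rightarrow> real \<Rightarrow> real \<Rightarrow> real \<Rightarrow> real" where
  "b_fun l \<tau> \<xi> x =
     l powr (1/6) *
     Airy_ext (l powr (1/3) * \<tau>) (- (l powr (1/6)) * \<xi> + (1 + sqrt l) powr (1/3) * x)"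

definition C_fun :: "real \<Rightarrow> real \<Rightarrow> real \<Rightarrow> real \<Rightarrow> real" where
  "C_fun l \<tau> \<xi> x = b_fun l \<tau> \<xi> x - B_fun l \<tau> \<xi> x"

definition sigma_tilde :: "real \<Rightarrow> real \<Rightarrow> real" where
  "sigma_tilde l \<sigma> = l powr (1/6) * (1 + sqrt l) powr (2/3) * \<sigma>"

text \<open>Real square-integrable functions on the half-line \<open>(a, \<infinity>)\<close>.  Elements are
  functions, not classes modulo null sets; values outside the half-line are irrelevant.\<close>

definition L2_halfline :: "real \<Rightarrow> (real \<Rightarrow> real) set" where
  "L2_halfline a =
     {f. set_borel_measurable lborel {a<..} f \<and> set_integrable lborel {a<..} (\<lambda>x. (f x)^2)}"

definition L2_inner :: "real \<Rightarrow> (real \<Rightarrow> real) \<Rightarrow> (real \<Rightarrow> real) \<Rightarrow> real" where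
  "L2_inner a f g = (LBINT x:{a<..}. f x * g x)"

text \<open>The integral operator with kernel \<open>\<chi>\<^sub>a K \<chi>\<^sub>a\<close>, where \<open>\<chi>\<^sub>a\<close> is the
  indicator of \<open>(a, \<infinity>)\<close>.\<close>

definition K_Airy_op :: "real \<Rightarrow> (real \<Rightarrow> real) \<Rightarrow> real \<Rightarrow> real" where
  "K_Airy_op a g x = indicator {a<..} x * (LBINT y:{a<..}. K_Airy x y * g y)"

text \<open>The inverse of \<open>1 - \<chi>\<^sub>a K \<chi>\<^sub>a\<close> on \<open>L\<^sup>2((a, \<infinity>))\<close>.  Since the operator is
  invertible, the preimage of a function in that space is determined up to a null set;
  the choice below picks a representative.\<close>

definition Airy_resolvent :: "real \<Rightarrow> (real \<Rightarrow> real) \<Rightarrow> real \<Rightarrow> real" where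
  "Airy_resolvent a f =
     (SOME g. g \<in> L2_halfline a \<and> (AE x in lborel. x > a \<longrightarrow> g x - K_Airy_op a g x = f x))"

definition L_tac :: "real \<Rightarrow> real \<Rightarrow> real \<Rightarrow> real \<Rightarrow> real \<Rightarrow> real \<Rightarrow> real" where
  "L_tac l \<sigma> \<tau>1 \<xi>1 \<tau>2 \<xi>2 =
     K_Airy_ext (- \<tau>1) \<tau>2 (\<sigma> + \<xi>1) (\<sigma> + \<xi>2)
     + (1 + sqrt (1 / l)) powr (1/3) *
       L2_inner (sigma_tilde l \<sigma>)
         (\<lambda>x. B_fun l \<tau>2 (\<sigma> + \<xi>2) x - b_fun l \<tau>2 (\<sigma> + \<xi>2) x)
         (Airy_resolvent (sigma_tilde l \<sigma>) (B_fun l (- \<tau>1) (\<sigma> + \<xi>1)))"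

definition tacnode_kernel :: "real \<Rightarrow> real \<Rightarrow> real \<Rightarrow> real \<Rightarrow> real \<Rightarrow> real \<Rightarrow> real" where
  "tacnode_kernel l \<sigma> \<tau>1 \<xi>1 \<tau>2 \<xi>2 =
     - of_bool (\<tau>1 < \<tau>2) * heat_kernel (\<tau>2 - \<tau>1) \<xi>1 \<xi>2
     + L_tac l \<sigma> \<tau>1 \<xi>1 \<tau>2 \<xi>2
     + l powr (1/6) *
       L_tac (1 / l) (l powr (2/3) * \<sigma>)
         (l powr (1/3) * \<tau>1) (- (l powr (1/6)) * \<xi>1)
         (l powr (1/3) * \<tau>2) (- (l powr (1/6)) * \<xi>2)"

definition L_tac_tilde :: "real \<Rightarrow> real \<Rightarrow> real \<Rightarrow> real \<Rightarrow> real \<Rightarrow> real \<Rightarrow> real" where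
  "L_tac_tilde l \<sigma> \<tau>1 \<xi>1 \<tau>2 \<xi>2 =
     (1 + sqrt (1 / l)) powr (1/3) *
     (LBINT x:{sigma_tilde l \<sigma><..}.
        Airy_resolvent (sigma_tilde l \<sigma>) (C_fun l (- \<tau>1) (\<sigma> + \<xi>1)) x
        * b_fun l \<tau>2 (\<sigma> + \<xi>2) x)"

end

theory Submission
  imports Defs "HOL-Probability.Characteristic_Functions" "HOL-Complex_Analysis.Complex_Analysis"
begin

text \<open>
  Write \<open>a\<close> for \<open>sigma_tilde l \<sigma>\<close> and let \<open>H\<close> be the operator on \<open>L\<^sup>2(a, \<infinity>)\<close> with the symmetric
  kernel \<open>Ai(x + y - a)\<close>.  Then \<open>H\<^sup>2\<close> is the Airy kernel operator, and because of the choice of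
  \<open>a\<close> the functions \<open>B\<close> are, up to powers of \<open>\<lambda>\<close>, the images under \<open>H\<close> of the functions \<open>b\<close> for
  the dual parameters \<open>(1/\<lambda>, \<lambda>\<^bsup>2/3\<^esup>\<sigma>)\<close>.  The claim is then the identity
  \<open>H (1 - H\<^sup>2)\<^sup>-\<^sup>1 H = (1 - H\<^sup>2)\<^sup>-\<^sup>1 - 1\<close>, the leftover \<open>- 1\<close> cancelling the extended Airy kernel.

  Since the inverse is a chosen preimage, one needs that \<open>1 - H\<^sup>2\<close> is invertible, that is,
  \<open>\<parallel>H\<parallel> < 1\<close>.  Shifting the contour in the Airy integral to height \<open>\<eta> > 0\<close> writes the Airy
  transform as a composition of two Fourier transforms and a Gaussian multiplier; Bessel's
  inequality and \<open>\<eta> \<rightarrow> 0\<close> show that it is a contraction from \<open>L\<^sup>2(a, \<infinity>)\<close> to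
  \<open>L\<^sup>2(\<real>)\<close>.  If \<open>H\<close> had norm one, compactness (Montel's theorem) would give \<open>f \<noteq> 0\<close> with
  \<open>H\<^sup>2f = f\<close>, so that the Airy transform of \<open>f\<close> vanishes on \<open>(-\<infinity>, a)\<close>; being entire,
  it vanishes identically, a contradiction.
\<close>

section \<open>Hilbert--Schmidt operators and Neumann series\<close>

text \<open>Let \<open>b1\<close>, \<open>b2\<close> be the functions \<open>b\<close> at
  \<open>- \<tau>1\<close> and \<open>\<tau>2\<close>, let \<open>d1\<close>, \<open>d2\<close> be
  their duals, let R be the inverse of 1 - H^2 and c = (1 + sqrt(1/l))^(1/3). Then
  \<open>L_tac\<close> is c l^(1/3) <d2, R d1> - c l^(1/6) <b2, H R d1>, while
  \<open>L_tac_tilde\<close> is c <b2, R b1> minus the same cross term. The two thus differ only in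
  the diagonal term. Passing to the dual parameters keeps H and exchanges the b's with the d's, so
  in the full kernel the diagonal terms of the two summands change places; this is why the identity
  is one for the sum. Limits are controlled pointwise: each row of the kernel lies in L2, so
  \<open>\<bar>H f x\<bar>\<close> is at most \<open>row x\<close> times the norm of f, and
  \<open>row\<close> is itself an L2 majorant for dominated convergence. The Fourier representation
  of the Airy function cannot be used at height 0, where its integral converges only conditionally.
  Every estimate is therefore made at a positive height, where exponential weights appear in x and
  in y. The weight in y is at most 1 right of a; the one in x disappears only in the limit.\<close>

definition L2_space :: "'a measure \<Rightarrow> ('a \<Rightarrow> real) set" where
  "L2_space M = {f \<in> borel_measurable M. integrable M (\<lambda>x. (f x)\<^sup>2)}"

definition L2_norm_on :: "'a measure \<Rightarrow> ('a \<Rightarrow> real) \<Rightarrow> real" where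
  "L2_norm_on M f = sqrt (\<integral>x. (f x)\<^sup>2 \<partial>M)"

lemma L2_measurable: "f \<in> L2_space M \<Longrightarrow> f \<in> borel_measurable M"
  and L2_integrable: "f \<in> L2_space M \<Longrightarrow> integrable M (\<lambda>x. (f x)\<^sup>2)"
  by (auto simp: L2_space_def)

lemma L2_norm_on_nonneg [simp]: "0 \<le> L2_norm_on M f"
  by (simp add: L2_norm_on_def)

lemma L2_norm_on_square: "(L2_norm_on M f)\<^sup>2 = (\<integral>x. (f x)\<^sup>2 \<partial>M)"
  by (simp add: L2_norm_on_def)

lemma L2_mult_integrable:
  assumes "f \<in> L2_space M" "g \<in> L2_space M"
  shows "integrable M (\<lambda>x. f x * g x)"
proof (rule Bochner_Integration.integrable_bound)
  show "integrable M (\<lambda>x. (f x)\<^sup>2 + (g x)\<^sup>2)"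
    using assms by (simp add: L2_integrable)
  show "(\<lambda>x. f x * g x) \<in> borel_measurable M"
    using assms[THEN L2_measurable] by measurable
  have "\<bar>u * v\<bar> \<le> u\<^sup>2 + v\<^sup>2" for u v :: real
    using sum_squares_bound[of "\<bar>u\<bar>" "\<bar>v\<bar>"] abs_ge_zero[of "u * v"]
    unfolding abs_mult power2_abs by linarith
  then show "AE x in M. norm (f x * g x) \<le> norm ((f x)\<^sup>2 + (g x)\<^sup>2)"
    by simp
qed

lemma L2_scale: "f \<in> L2_space M \<Longrightarrow> (\<lambda>x. c * f x) \<in> L2_space M"
  by (auto simp: L2_space_def power_mult_distrib)

lemma L2_add:
  assumes "f \<in> L2_space M" "g \<in> L2_space M"
  shows "(\<lambda>x. f x + g x) \<in> L2_space M"
proof -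
  have "integrable M (\<lambda>x. (f x)\<^sup>2 + (g x)\<^sup>2 + 2 * (f x * g x))"
    using assms L2_mult_integrable[OF assms] by (auto simp: L2_integrable)
  then show ?thesis
    using assms by (auto simp: L2_space_def power2_sum algebra_simps)
qed

lemma L2_diff:
  assumes "f \<in> L2_space M" "g \<in> L2_space M"
  shows "(\<lambda>x. f x - g x) \<in> L2_space M"
  using L2_add[OF assms(1) L2_scale[OF assms(2), of "-1"]] by simp

lemma L2_bound:
  assumes "f \<in> borel_measurable M" "g \<in> L2_space M" "AE x in M. \<bar>f x\<bar> \<le> \<bar>g x\<bar>"
  shows "f \<in> L2_space M"
proof -
  have "integrable M (\<lambda>x. (f x)\<^sup>2)"
    by (rule Bochner_Integration.integrable_bound[OF L2_integrable[OF assms(2)]])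
      (use assms in \<open>auto simp: abs_le_square_iff\<close>)
  then show ?thesis using assms by (simp add: L2_space_def)
qed

lemma L2_norm_on_scale: "L2_norm_on M (\<lambda>x. c * f x) = \<bar>c\<bar> * L2_norm_on M f"
  by (simp add: L2_norm_on_def power_mult_distrib real_sqrt_mult)

text \<open>Discriminant argument for the nonnegative quadratic polynomial t -> ||f + t
  g||^2.\<close>

lemma L2_Cauchy_Schwarz:
  assumes f: "f \<in> L2_space M" and g: "g \<in> L2_space M"
  shows "\<bar>\<integral>x. f x * g x \<partial>M\<bar> \<le> L2_norm_on M f * L2_norm_on M g"
proof -
  define A where "A = (\<integral>x. (f x)\<^sup>2 \<partial>M)"
  define B where "B = (\<integral>x. f x * g x \<partial>M)"
  define C where "C = (\<integral>x. (g x)\<^sup>2 \<partial>M)"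
  have quad: "0 \<le> A + 2 * t * B + t\<^sup>2 * C" for t
  proof -
    have "0 \<le> (\<integral>x. (f x + t * g x)\<^sup>2 \<partial>M)" by simp
    also have "(\<lambda>x. (f x + t * g x)\<^sup>2) = (\<lambda>x. (f x)\<^sup>2 + 2 * t * (f x * g x) + t\<^sup>2 * (g x)\<^sup>2)"
      by (auto simp: power2_eq_square algebra_simps)
    also have "(\<integral>x. (f x)\<^sup>2 + 2 * t * (f x * g x) + t\<^sup>2 * (g x)\<^sup>2 \<partial>M) = A + 2 * t * B + t\<^sup>2 * C"
      using f g L2_mult_integrable[OF f g] unfolding A_def B_def C_def
      by (simp add: L2_integrable)
    finally show ?thesis .
  qed
  have "B\<^sup>2 \<le> A * C"
  proof (cases "C = 0")
    case True
    have "B = 0"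
    proof (rule ccontr)
      assume "B \<noteq> 0"
      \<comment> \<open>With C = 0 the polynomial is affine in t, and this t gives it the value -1.
        In the other case t = -B/C is its minimiser.\<close>
      then show False
        using quad[of "-(A + 1) / (2 * B)"] True by (simp add: field_simps)
    qed
    then show ?thesis using True by simp
  next
    case False
    then have "C > 0" unfolding C_def by (simp add: order_less_le)
    then show ?thesis
      using quad[of "- B / C"] by (simp add: field_simps power2_eq_square)
  qed
  then have "sqrt (B\<^sup>2) \<le> sqrt (A * C)" by (rule real_sqrt_le_mono)
  then show ?thesis
    by (simp add: A_def B_def C_def L2_norm_on_def real_sqrt_mult)
qed

lemma L2_norm_on_mono:
  assumes "f \<in> borel_measurable M" "g \<in> L2_space M" "AE x in M. \<bar>f x\<bar> \<le> \<bar>g x\<bar>"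
  shows "L2_norm_on M f \<le> L2_norm_on M g"
  unfolding L2_norm_on_def
  by (rule real_sqrt_le_mono, rule integral_mono_AE)
    (use L2_bound[OF assms] assms in \<open>auto simp: L2_integrable abs_le_square_iff\<close>)

lemma L2_norm_on_eq_0:
  assumes "f \<in> L2_space M" "L2_norm_on M f = 0"
  shows "AE x in M. f x = 0"
proof -
  have "(\<integral>x. (f x)\<^sup>2 \<partial>M) = 0" using assms by (simp add: L2_norm_on_def)
  then show ?thesis
    using integral_nonneg_eq_0_iff_AE[OF L2_integrable[OF assms(1)]] by simp
qed

section \<open>Symmetric Hilbert-Schmidt kernels\<close>

locale hilbert_schmidt = sigma_finite_measure M for M :: "'a measure" +
  fixes k :: "'a \<Rightarrow> 'a \<Rightarrow> real"
  assumes k_measurable [measurable]: "case_prod k \<in> borel_measurable (M \<Otimes>\<^sub>M M)"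
    and k_sym: "k x y = k y x"
    and k_row: "x \<in> space M \<Longrightarrow> integrable M (\<lambda>y. (k x y)\<^sup>2)"
    and k_hs: "integrable M (\<lambda>x. \<integral>y. (k x y)\<^sup>2 \<partial>M)"
begin

definition row :: "'a \<Rightarrow> real" where
  "row x = L2_norm_on M (k x)"

definition H :: "('a \<Rightarrow> real) \<Rightarrow> 'a \<Rightarrow> real" where
  "H f x = (\<integral>y. k x y * f y \<partial>M)"

sublocale pair_sigma_finite M M ..

lemma k_L2: "x \<in> space M \<Longrightarrow> k x \<in> L2_space M"
  using k_row by (auto simp: L2_space_def)

lemma k_row_measurable: "x \<in> space M \<Longrightarrow> k x \<in> borel_measurable M"
  using k_L2 L2_measurable by blast

lemma row_measurable [measurable]: "row \<in> borel_measurable M"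
  unfolding row_def L2_norm_on_def by measurable

lemma row_nonneg [simp]: "0 \<le> row x"
  by (simp add: row_def)

lemma row_L2: "row \<in> L2_space M"
  using k_hs by (auto simp: L2_space_def row_def L2_norm_on_def)

lemma H_measurable [measurable]:
  assumes [measurable]: "f \<in> borel_measurable M"
  shows "H f \<in> borel_measurable M"
  unfolding H_def by measurable

lemma H_bound:
  assumes "f \<in> L2_space M" "x \<in> space M"
  shows "\<bar>H f x\<bar> \<le> row x * L2_norm_on M f"
  using L2_Cauchy_Schwarz[OF k_L2[OF assms(2)] assms(1)] by (simp add: H_def row_def)

lemma H_L2:
  assumes "f \<in> L2_space M" shows "H f \<in> L2_space M"
proof (rule L2_bound[OF _ L2_scale[OF row_L2, of "L2_norm_on M f"]])
  show "H f \<in> borel_measurable M" using L2_measurable[OF assms] by measurable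
  show "AE x in M. \<bar>H f x\<bar> \<le> \<bar>L2_norm_on M f * row x\<bar>"
    using H_bound[OF assms] by (auto simp: abs_mult mult.commute)
qed

lemma H_add:
  assumes "f \<in> L2_space M" "g \<in> L2_space M" "x \<in> space M"
  shows "H (\<lambda>y. f y + g y) x = H f x + H g x"
  using L2_mult_integrable[OF k_L2[OF assms(3)] assms(1)]
    L2_mult_integrable[OF k_L2[OF assms(3)] assms(2)]
  by (simp add: H_def distrib_left)

lemma H_diff:
  assumes "f \<in> L2_space M" "g \<in> L2_space M" "x \<in> space M"
  shows "H (\<lambda>y. f y - g y) x = H f x - H g x"
  using L2_mult_integrable[OF k_L2[OF assms(3)] assms(1)]
    L2_mult_integrable[OF k_L2[OF assms(3)] assms(2)]
  by (simp add: H_def right_diff_distrib)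

lemma H_scale: "H (\<lambda>y. c * f y) x = c * H f x"
  by (simp add: H_def mult.left_commute)

text \<open>An integral ignores null sets, so the conclusion holds at every point: applying
  \<open>H\<close> turns an equation almost everywhere into one everywhere.\<close>

lemma H_cong:
  assumes "f \<in> borel_measurable M" "g \<in> borel_measurable M" "AE x in M. f x = g x" "x \<in> space M"
  shows "H f x = H g x"
  unfolding H_def by (rule integral_cong_AE) (use assms k_row_measurable[OF assms(4)] in auto)

text \<open>A product of two L2 functions is integrable, so \<open>\<bar>k x y\<bar> * d y\<close>
  serves as majorant for dominated convergence in y.\<close>

lemma H_tendsto:
  assumes x: "x \<in> space M" and G: "\<And>N. G N \<in> borel_measurable M" and G': "G' \<in> borel_measurable M"
    and d: "d \<in> L2_space M" and Gd: "\<And>y N. y \<in> space M \<Longrightarrow> \<bar>G N y\<bar> \<le> d y"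
    and lim: "\<And>y. y \<in> space M \<Longrightarrow> (\<lambda>N. G N y) \<longlonglongrightarrow> G' y"
  shows "(\<lambda>N. H (G N) x) \<longlonglongrightarrow> H G' x"
  unfolding H_def
proof (rule integral_dominated_convergence[where w = "\<lambda>y. \<bar>k x y\<bar> * d y"])
  have "(\<lambda>y. \<bar>k x y\<bar>) \<in> L2_space M" using k_L2[OF x] by (auto simp: L2_space_def)
  from L2_mult_integrable[OF this d] show "integrable M (\<lambda>y. \<bar>k x y\<bar> * d y)" .
  show "AE y in M. norm (k x y * G N y) \<le> \<bar>k x y\<bar> * d y" for N
    using Gd by (auto simp: abs_mult intro!: mult_left_mono)
  show "AE y in M. (\<lambda>N. k x y * G N y) \<longlonglongrightarrow> k x y * G' y"
    using lim by (auto intro!: tendsto_mult)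
qed (use G G' k_row_measurable[OF x] in auto)

text \<open>Fubini's condition for both self-adjointness and the composition kernel. Cauchy-Schwarz
  in y bounds the inner integral by a multiple of \<open>row x\<close>, and f times
  \<open>row\<close> is integrable.\<close>

lemma H_kernel_integrable:
  assumes f: "f \<in> L2_space M" and g: "g \<in> L2_space M"
  shows "integrable (M \<Otimes>\<^sub>M M) (\<lambda>(x, y). f x * (k x y * g y))"
proof (rule Fubini_integrable)
  note [measurable] = f[THEN L2_measurable] g[THEN L2_measurable]
  show "(\<lambda>(x, y). f x * (k x y * g y)) \<in> borel_measurable (M \<Otimes>\<^sub>M M)" by measurable
  have row: "(\<integral>y. \<bar>k x y * g y\<bar> \<partial>M) \<le> row x * L2_norm_on M g" if "x \<in> space M" for x
  proof -
    have kx: "(\<lambda>y. \<bar>k x y\<bar>) \<in> L2_space M" and ga: "(\<lambda>y. \<bar>g y\<bar>) \<in> L2_space M"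
      using k_L2[OF that] g by (auto simp: L2_space_def)
    show ?thesis
      using L2_Cauchy_Schwarz[OF kx ga] by (simp add: abs_mult row_def L2_norm_on_def)
  qed
  show "integrable M (\<lambda>x. \<integral>y. norm (case (x, y) of (x, y) \<Rightarrow> f x * (k x y * g y)) \<partial>M)"
  proof (rule Bochner_Integration.integrable_bound)
    show "integrable M (\<lambda>x. L2_norm_on M g * (f x * row x))"
      using L2_mult_integrable[OF f row_L2] by simp
    show "AE x in M. norm (\<integral>y. norm (case (x, y) of (x, y) \<Rightarrow> f x * (k x y * g y)) \<partial>M)
        \<le> norm (L2_norm_on M g * (f x * row x))"
    proof (rule AE_I2)
      fix x assume x: "x \<in> space M"
      have "(\<integral>y. \<bar>f x * (k x y * g y)\<bar> \<partial>M) = \<bar>f x\<bar> * (\<integral>y. \<bar>k x y * g y\<bar> \<partial>M)"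
        by (simp add: abs_mult)
      also have "\<dots> \<le> \<bar>f x\<bar> * (row x * L2_norm_on M g)"
        by (rule mult_left_mono[OF row[OF x]]) simp
      finally show "norm (\<integral>y. norm (case (x, y) of (x, y) \<Rightarrow> f x * (k x y * g y)) \<partial>M)
        \<le> norm (L2_norm_on M g * (f x * row x))"
        by (simp add: abs_mult mult_ac)
    qed
  qed measurable
  show "AE x in M. integrable M (\<lambda>y. case (x, y) of (x, y) \<Rightarrow> f x * (k x y * g y))"
    using L2_mult_integrable[OF k_L2 g] by auto
qed

lemma H_self_adjoint:
  assumes f: "f \<in> L2_space M" and g: "g \<in> L2_space M"
  shows "(\<integral>x. f x * H g x \<partial>M) = (\<integral>x. H f x * g x \<partial>M)"
proof -
  have "(\<integral>x. f x * H g x \<partial>M) = (\<integral>x. (\<integral>y. f x * (k x y * g y) \<partial>M) \<partial>M)"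
    by (simp add: H_def)
  also have "\<dots> = (\<integral>y. (\<integral>x. f x * (k x y * g y) \<partial>M) \<partial>M)"
    using Fubini_integral[OF H_kernel_integrable[OF f g]] by simp
  also have "\<dots> = (\<integral>y. H f y * g y \<partial>M)"
  proof -
    have "f x * (k x y * g y) = (k y x * f x) * g y" for x y
      using k_sym[of x y] by simp
    then have "(\<lambda>x. f x * (k x y * g y)) = (\<lambda>x. (k y x * f x) * g y)" for y by blast
    then show ?thesis by (simp add: H_def)
  qed
  finally show ?thesis .
qed

text \<open>Fubini with the row \<open>k x\<close> as the left factor. This identifies the square of
  \<open>H\<close> with the Airy kernel operator later.\<close>

lemma H_H_kernel:
  assumes f: "f \<in> L2_space M" and x: "x \<in> space M"
  shows "H (H f) x = (\<integral>y. (\<integral>z. k x z * k z y \<partial>M) * f y \<partial>M)"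
proof -
  have "H (H f) x = (\<integral>z. (\<integral>y. k x z * (k z y * f y) \<partial>M) \<partial>M)"
    by (simp add: H_def)
  also have "\<dots> = (\<integral>y. (\<integral>z. k x z * (k z y * f y) \<partial>M) \<partial>M)"
    using Fubini_integral[OF H_kernel_integrable[OF k_L2[OF x] f]] by simp
  also have "\<dots> = (\<integral>y. (\<integral>z. k x z * k z y * f y \<partial>M) \<partial>M)"
    by (simp only: mult.assoc)
  finally show ?thesis by simp
qed

section \<open>Inverting 1 - H^2\<close>

lemma neumann_unique:
  assumes q: "q < 1" and contr: "\<And>f. f \<in> L2_space M \<Longrightarrow> L2_norm_on M (H f) \<le> q * L2_norm_on M f"
    and g: "g \<in> L2_space M" and eq: "AE x in M. g x - H (H g) x = 0"
  shows "AE x in M. g x = 0"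
proof -
  have "L2_norm_on M g = L2_norm_on M (H (H g))"
    unfolding L2_norm_on_def
    by (intro arg_cong[where f = sqrt] integral_cong_AE)
      (use eq g H_L2[OF g] H_L2[OF H_L2[OF g]] in \<open>auto dest: L2_measurable\<close>)
  also have "\<dots> \<le> q * L2_norm_on M (H g)" by (rule contr[OF H_L2[OF g]])
  finally have 1: "L2_norm_on M g \<le> q * L2_norm_on M (H g)" .
  have 2: "L2_norm_on M (H g) \<le> q * L2_norm_on M g" by (rule contr[OF g])
  have "L2_norm_on M g = 0"
  proof (rule ccontr)
    assume "L2_norm_on M g \<noteq> 0"
    then have pos: "0 < L2_norm_on M g" by (simp add: order_less_le)
    \<comment> \<open>The two estimates can be chained only for positive q; for q \<le> 0 the first
      one already forces the norm of g to vanish.\<close>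
    have "q > 0"
    proof (rule ccontr)
      assume "\<not> q > 0"
      then have "q * L2_norm_on M (H g) \<le> 0" by (simp add: mult_nonpos_nonneg)
      then show False using 1 pos by simp
    qed
    then have "q * L2_norm_on M (H g) \<le> q * (q * L2_norm_on M g)" using 2 by simp
    also have "\<dots> < L2_norm_on M g"
    proof -
      have "q * q < 1" using q \<open>q > 0\<close> mult_strict_mono[of q 1 q 1] by simp
      then show ?thesis using pos mult_strict_right_mono[of "q * q" 1] by (simp add: mult.assoc)
    qed
    finally show False using 1 by simp
  qed
  then show ?thesis by (rule L2_norm_on_eq_0[OF g])
qed

text \<open>The Neumann series is summed pointwise. Each later term is \<open>H\<close> applied to a
  function of norm at most \<open>p ^ n * L2_norm_on M f\<close>, hence is bounded at x by
  \<open>row x\<close> times this number. The geometric majorant gives convergence at every x and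
  the L2 bound \<open>row x * C\<close> for the sum.\<close>

lemma neumann_exists:
  assumes q: "0 \<le> q" "q < 1"
    and contr: "\<And>f. f \<in> L2_space M \<Longrightarrow> L2_norm_on M (H f) \<le> q * L2_norm_on M f"
    and f: "f \<in> L2_space M"
  shows "\<exists>g \<in> L2_space M. \<forall>x \<in> space M. g x - H (H g) x = f x"
proof -
  define T where "T n = ((\<lambda>f. H (H f)) ^^ n) f" for n
  have T_Suc: "T (Suc n) = H (H (T n))" for n by (simp add: T_def)
  have T_L2: "T n \<in> L2_space M" for n
    by (induction n) (auto simp: T_Suc H_L2 T_def f)
  have HT_L2: "H (T n) \<in> L2_space M" for n by (rule H_L2[OF T_L2])
  define p where "p = q * q"
  have p: "0 \<le> p" "p < 1" using q mult_strict_mono[of q 1 q 1] by (auto simp: p_def)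
  have HH: "L2_norm_on M (H (H g)) \<le> p * L2_norm_on M g" if g: "g \<in> L2_space M" for g
    using contr[OF H_L2[OF g]] mult_left_mono[OF contr[OF g] q(1)] by (simp add: p_def mult.assoc)
  have T_norm: "L2_norm_on M (T n) \<le> p ^ n * L2_norm_on M f" for n
  proof (induction n)
    case (Suc n)
    have "L2_norm_on M (T (Suc n)) \<le> p * L2_norm_on M (T n)"
      using HH[OF T_L2] by (simp add: T_Suc)
    also have "\<dots> \<le> p * (p ^ n * L2_norm_on M f)" by (rule mult_left_mono[OF Suc p(1)])
    finally show ?case by simp
  qed (simp add: T_def)
  have HT_norm: "L2_norm_on M (H (T n)) \<le> p ^ n * L2_norm_on M f" for n
  proof -
    have "L2_norm_on M (H (T n)) \<le> 1 * L2_norm_on M (T n)"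
      using contr[OF T_L2[of n]] mult_right_mono[of q 1 "L2_norm_on M (T n)"] q by simp
    then show ?thesis using T_norm[of n] by simp
  qed
  define C where "C = L2_norm_on M f / (1 - p)"
  have C: "0 \<le> C" using p by (simp add: C_def)
  have geo: "(\<lambda>n. p ^ n * L2_norm_on M f) sums C"
    using sums_mult2[OF geometric_sums[of p], of "L2_norm_on M f"] p by (simp add: C_def)
  have bound: "\<bar>T (Suc n) x\<bar> \<le> row x * (p ^ n * L2_norm_on M f)" if "x \<in> space M" for n x
  proof -
    have "\<bar>T (Suc n) x\<bar> \<le> row x * L2_norm_on M (H (T n))"
      using H_bound[OF HT_L2 that] by (simp add: T_Suc)
    also have "\<dots> \<le> row x * (p ^ n * L2_norm_on M f)"
      by (rule mult_left_mono[OF HT_norm]) simp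
    finally show ?thesis .
  qed
  have row_geo: "(\<lambda>n. row x * (p ^ n * L2_norm_on M f)) sums (row x * C)" for x
    by (rule sums_mult[OF geo])
  have sumT: "summable (\<lambda>n. \<bar>T (Suc n) x\<bar>)" if "x \<in> space M" for x
    by (rule summable_comparison_test'[OF sums_summable[OF row_geo[of x]], of 0])
      (use bound[OF that] in simp)
  \<comment> \<open>The sum starts at \<open>T 1\<close>: the term \<open>T 0 = f\<close> is not an
    image under \<open>H\<close>, so it has no bound by \<open>row\<close> and is carried
    separately.\<close>
  define S where "S x = (\<Sum>n. T (Suc n) x)" for x
  define g where "g x = f x + S x" for x
  have S_bound: "\<bar>S x\<bar> \<le> row x * C" if x: "x \<in> space M" for x
  proof -
    have "\<bar>S x\<bar> \<le> (\<Sum>n. \<bar>T (Suc n) x\<bar>)" unfolding S_def by (rule summable_rabs[OF sumT[OF x]])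
    also have "\<dots> \<le> (\<Sum>n. row x * (p ^ n * L2_norm_on M f))"
      by (rule suminf_le[OF bound[OF x] sumT[OF x] sums_summable[OF row_geo]])
    finally show ?thesis using sums_unique[OF row_geo[of x]] by simp
  qed
  have [measurable]: "T n \<in> borel_measurable M" for n using L2_measurable[OF T_L2] .
  have S_meas [measurable]: "S \<in> borel_measurable M" unfolding S_def by measurable
  have S_L2: "S \<in> L2_space M"
    by (rule L2_bound[OF S_meas L2_scale[OF row_L2, of C]])
      (use S_bound C in \<open>auto simp: abs_mult mult.commute\<close>)
  have g_L2: "g \<in> L2_space M" unfolding g_def by (rule L2_add[OF f S_L2])
  have partial_L2: "(\<lambda>x. \<Sum>n<N. T n x) \<in> L2_space M" for N
  proof (induction N)
    case (Suc N) then show ?case using L2_add[OF Suc T_L2] by simp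
  qed (simp add: L2_space_def)
  have partial_bound: "\<bar>\<Sum>n<N. T n x\<bar> \<le> \<bar>f x\<bar> + row x * C" if x: "x \<in> space M" for N x
  proof (cases N)
    case 0 then show ?thesis using C by simp
  next
    case (Suc N')
    have "\<bar>\<Sum>n<N'. T (Suc n) x\<bar> \<le> (\<Sum>n<N'. \<bar>T (Suc n) x\<bar>)" by (rule sum_abs)
    also have "\<dots> \<le> (\<Sum>n<N'. row x * (p ^ n * L2_norm_on M f))"
      by (rule sum_mono) (rule bound[OF x])
    also have "\<dots> \<le> row x * C"
      using sum_le_suminf[OF sums_summable[OF row_geo[of x]], of "{..<N'}"]
        sums_unique[OF row_geo[of x]] p by simp
    finally show ?thesis unfolding Suc sum.lessThan_Suc_shift by (simp add: T_def)
  qed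
  have partial_lim: "(\<lambda>N. \<Sum>n<N. T n x) \<longlonglongrightarrow> g x" if x: "x \<in> space M" for x
  proof -
    have "(\<lambda>n. T (Suc n) x) sums S x"
      unfolding S_def using summable_rabs_cancel[OF sumT[OF x]] by (rule summable_sums)
    then have "(\<lambda>n. T n x) sums (S x + T 0 x)" by (rule sums_Suc)
    then show ?thesis by (simp add: sums_def g_def T_def add.commute)
  qed
  define d where "d y = \<bar>f y\<bar> + row y * C" for y
  have d_L2: "d \<in> L2_space M"
  proof -
    have "(\<lambda>y. \<bar>f y\<bar>) \<in> L2_space M" using f by (auto simp: L2_space_def)
    from L2_add[OF this L2_scale[OF row_L2, of C]] show ?thesis by (simp add: d_def[abs_def] mult.commute)
  qed
  have HH_sum: "H (H (\<lambda>y. \<Sum>n<N. T n y)) x = (\<Sum>n<N. T (Suc n) x)" if x: "x \<in> space M" for N x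
  proof -
    have 1: "H (\<lambda>y. \<Sum>n<N. T n y) y = (\<Sum>n<N. H (T n) y)" if y: "y \<in> space M" for y
    proof (induction N)
      case (Suc N) then show ?case using H_add[OF partial_L2 T_L2 y] by simp
    qed (simp add: H_def)
    have HT_partial: "(\<lambda>y. \<Sum>n<N. H (T n) y) \<in> L2_space M" for N
    proof (induction N)
      case (Suc N) then show ?case using L2_add[OF Suc HT_L2] by simp
    qed (simp add: L2_space_def)
    have "H (H (\<lambda>y. \<Sum>n<N. T n y)) x = H (\<lambda>y. \<Sum>n<N. H (T n) y) x"
      unfolding H_def[of "H (\<lambda>y. \<Sum>n<N. T n y)"] H_def[of "\<lambda>y. \<Sum>n<N. H (T n) y"]
      by (rule Bochner_Integration.integral_cong) (simp_all add: 1)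
    also have "\<dots> = (\<Sum>n<N. T (Suc n) x)"
    proof (induction N)
      case (Suc N) then show ?case using H_add[OF HT_partial HT_L2 x] by (simp add: T_Suc)
    qed (simp add: H_def)
    finally show ?thesis .
  qed
  have "g x - H (H g) x = f x" if x: "x \<in> space M" for x
  proof -
    have gm: "g \<in> borel_measurable M" using L2_measurable[OF g_L2] .
    have lim1: "(\<lambda>N. H (\<lambda>y. \<Sum>n<N. T n y) y) \<longlonglongrightarrow> H g y" if y: "y \<in> space M" for y
      by (rule H_tendsto[OF y _ gm d_L2]) (use partial_bound partial_lim in \<open>auto simp: d_def\<close>)
    \<comment> \<open>Two limits are exchanged with \<open>H\<close>, the inner one with majorant
      \<open>d\<close>. For the outer one the images of the partial sums need a majorant independent
      of N, again a multiple of \<open>row\<close>.\<close>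
    have b1: "\<bar>H (\<lambda>y. \<Sum>n<N. T n y) y\<bar> \<le> L2_norm_on M d * row y" if y: "y \<in> space M" for N y
    proof -
      have "L2_norm_on M (\<lambda>y. \<Sum>n<N. T n y) \<le> L2_norm_on M d"
        by (rule L2_norm_on_mono[OF _ d_L2])
          (use partial_bound in \<open>auto simp: d_def intro!: order_trans[OF _ abs_ge_self]\<close>)
      then have "row y * L2_norm_on M (\<lambda>y. \<Sum>n<N. T n y) \<le> row y * L2_norm_on M d"
        by (rule mult_left_mono) simp
      then show ?thesis using H_bound[OF partial_L2[of N] y] by (simp add: mult.commute)
    qed
    have "(\<lambda>N. H (H (\<lambda>y. \<Sum>n<N. T n y)) x) \<longlonglongrightarrow> H (H g) x"
      by (rule H_tendsto[OF x _ _ L2_scale[OF row_L2, of "L2_norm_on M d"]])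
        (use lim1 b1 gm in auto)
    then have "(\<lambda>N. \<Sum>n<N. T (Suc n) x) \<longlonglongrightarrow> H (H g) x" by (simp only: HH_sum[OF x])
    then have "(\<lambda>n. T (Suc n) x) sums H (H g) x" by (simp add: sums_def)
    then have "S x = H (H g) x" unfolding S_def by (rule sums_unique[symmetric])
    then show ?thesis by (simp add: g_def)
  qed
  then show ?thesis using g_L2 by blast
qed

text \<open>A sequence \<open>F\<^sub>n\<close> of unit vectors with \<open>\<parallel>H F\<^sub>n\<parallel> \<rightarrow> 1\<close> satisfies
  \<open>\<parallel>F\<^sub>n - H\<^sup>2 F\<^sub>n\<parallel>\<^sup>2 \<le> 2 - 2 \<parallel>H F\<^sub>n\<parallel>\<^sup>2 \<rightarrow> 0\<close>, so a limit of \<open>H F\<^sub>n\<close> is a unit vector fixed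
  by \<open>H\<^sup>2\<close>.\<close>

lemma contraction_gap:
  assumes contr: "\<And>f. f \<in> L2_space M \<Longrightarrow> L2_norm_on M (H f) \<le> L2_norm_on M f"
    and inj: "\<And>f. f \<in> L2_space M \<Longrightarrow> AE x in M. H (H f) x = f x \<Longrightarrow> AE x in M. f x = 0"
    and cpt: "\<And>F. (\<And>n. F n \<in> L2_space M) \<Longrightarrow> (\<And>n. L2_norm_on M (F n) \<le> 1) \<Longrightarrow>
      \<exists>(r :: nat \<Rightarrow> nat) h. strict_mono r \<and> (\<forall>x \<in> space M. (\<lambda>n. H (F (r n)) x) \<longlonglongrightarrow> h x)"
  shows "\<exists>q. 0 \<le> q \<and> q < 1 \<and> (\<forall>f \<in> L2_space M. L2_norm_on M (H f) \<le> q * L2_norm_on M f)"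
proof (rule ccontr)
  assume no: "\<not> ?thesis"
  \<comment> \<open>Negating the claim at the bounds Q n, which tend to 1, produces functions that
    after normalisation form the maximising sequence.\<close>
  define Q where "Q n = 1 - 1 / real (Suc n)" for n
  have Q: "0 \<le> Q n" "Q n < 1" for n by (auto simp: Q_def)
  have "\<exists>f \<in> L2_space M. \<not> L2_norm_on M (H f) \<le> Q n * L2_norm_on M f" for n
    using no Q[of n] by blast
  then obtain f0 where f0: "\<And>n. f0 n \<in> L2_space M"
    and f0': "\<And>n. \<not> L2_norm_on M (H (f0 n)) \<le> Q n * L2_norm_on M (f0 n)" by metis
  have pos: "0 < L2_norm_on M (f0 n)" for n
    using contr[OF f0[of n]] f0'[of n] L2_norm_on_nonneg[of M "f0 n"]
    by (cases "L2_norm_on M (f0 n) = 0") (auto simp: order_less_le)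
  define F where "F n x = inverse (L2_norm_on M (f0 n)) * f0 n x" for n x
  have F: "F n \<in> L2_space M" for n unfolding F_def by (rule L2_scale[OF f0])
  have F1: "L2_norm_on M (F n) = 1" for n
    unfolding F_def L2_norm_on_scale using pos[of n] by simp
  have HF: "Q n \<le> L2_norm_on M (H (F n))" for n
  proof -
    have "H (F n) = (\<lambda>x. inverse (L2_norm_on M (f0 n)) * H (f0 n) x)"
      unfolding F_def by (rule ext) (rule H_scale)
    then have "L2_norm_on M (H (F n)) = \<bar>inverse (L2_norm_on M (f0 n))\<bar> * L2_norm_on M (H (f0 n))"
      by (simp only: L2_norm_on_scale)
    then have "L2_norm_on M (H (F n)) * L2_norm_on M (f0 n) = L2_norm_on M (H (f0 n))"
      using pos[of n] by simp
    then have "Q n * L2_norm_on M (f0 n) \<le> L2_norm_on M (H (F n)) * L2_norm_on M (f0 n)"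
      using f0'[of n] by simp
    then show ?thesis using pos[of n] by (simp only: mult_le_cancel_right_pos)
  qed
  obtain r :: "nat \<Rightarrow> nat" and h where r: "strict_mono r"
    and lim: "\<And>x. x \<in> space M \<Longrightarrow> (\<lambda>n. H (F (r n)) x) \<longlonglongrightarrow> h x"
    using cpt[of F, OF F] F1 by auto
  define G where "G n = H (F (r n))" for n
  have G: "G n \<in> L2_space M" for n unfolding G_def by (rule H_L2[OF F])
  have G_le: "L2_norm_on M (G n) \<le> 1" for n
    using contr[OF F[of "r n"]] by (simp add: G_def F1)
  have Gm [measurable]: "G n \<in> borel_measurable M" for n using L2_measurable[OF G] .
  have Gb: "\<bar>G n x\<bar> \<le> row x" if "x \<in> space M" for n x
    using H_bound[OF F[of "r n"] that] by (simp add: G_def F1)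
  have lim': "(\<lambda>n. G n x) \<longlonglongrightarrow> h x" if "x \<in> space M" for x
    using lim[OF that] by (simp add: G_def)
  have hm [measurable]: "h \<in> borel_measurable M"
    by (rule borel_measurable_LIMSEQ_real[OF lim' Gm])
  have hb: "\<bar>h x\<bar> \<le> row x" if "x \<in> space M" for x
    by (rule LIMSEQ_le_const2[OF tendsto_rabs[OF lim'[OF that]]]) (use Gb[OF that] in auto)
  have h: "h \<in> L2_space M" by (rule L2_bound[OF hm row_L2]) (use hb in auto)
  have normG: "(\<lambda>n. L2_norm_on M (G n)) \<longlonglongrightarrow> 1"
  proof (rule tendsto_sandwich)
    show "\<forall>\<^sub>F n in sequentially. Q (r n) \<le> L2_norm_on M (G n)" using HF by (simp add: G_def)
    show "\<forall>\<^sub>F n in sequentially. L2_norm_on M (G n) \<le> 1" using G_le by simp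
    have "Q \<longlonglongrightarrow> 1 - 0" unfolding Q_def by (intro tendsto_diff tendsto_const LIMSEQ_Suc[OF lim_1_over_n])
    from LIMSEQ_subseq_LIMSEQ[OF this r] show "(\<lambda>n. Q (r n)) \<longlonglongrightarrow> 1" by (simp add: comp_def)
  qed simp
  \<comment> \<open>Pointwise convergence under an L2 majorant gives convergence of norms; it is
    used for the limit h and again for h - H^2 h.\<close>
  have sq_lim: "(\<lambda>n. \<integral>x. (U n x)\<^sup>2 \<partial>M) \<longlonglongrightarrow> (\<integral>x. (V x)\<^sup>2 \<partial>M)"
    if "\<And>n. U n \<in> borel_measurable M" "V \<in> borel_measurable M" "d \<in> L2_space M"
      "\<And>x n. x \<in> space M \<Longrightarrow> \<bar>U n x\<bar> \<le> d x" "\<And>x. x \<in> space M \<Longrightarrow> (\<lambda>n. U n x) \<longlonglongrightarrow> V x"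
    for U :: "nat \<Rightarrow> 'a \<Rightarrow> real" and V d
  proof (rule integral_dominated_convergence[OF _ _ L2_integrable[OF that(3)]])
    show "AE x in M. norm ((U n x)\<^sup>2) \<le> (d x)\<^sup>2" for n
      using power_mono[OF that(4) abs_ge_zero, of _ n 2] by (intro AE_I2) simp
    show "AE x in M. (\<lambda>n. (U n x)\<^sup>2) \<longlonglongrightarrow> (V x)\<^sup>2"
      using that(5) by (auto intro!: tendsto_power)
  qed (use that in auto)
  have h1: "L2_norm_on M h = 1"
  proof -
    have "(\<lambda>n. L2_norm_on M (G n)) \<longlonglongrightarrow> L2_norm_on M h"
      unfolding L2_norm_on_def by (intro tendsto_real_sqrt sq_lim[OF Gm hm row_L2 Gb lim'])
    then show ?thesis using normG LIMSEQ_unique by blast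
  qed
  have HG: "(\<lambda>n. H (G n) x) \<longlonglongrightarrow> H h x" if x: "x \<in> space M" for x
    by (rule H_tendsto[OF x Gm hm row_L2 Gb lim'])
  have HGb: "\<bar>H (G n) x\<bar> \<le> row x" if x: "x \<in> space M" for x n
    using H_bound[OF G[of n] x] mult_left_mono[OF G_le[of n] row_nonneg[of x]] by simp
  have HHG: "(\<lambda>n. H (H (G n)) x) \<longlonglongrightarrow> H (H h) x" if x: "x \<in> space M" for x
    by (rule H_tendsto[OF x _ _ row_L2 HGb HG]) auto
  have HHGb: "\<bar>H (H (G n)) x\<bar> \<le> row x" if x: "x \<in> space M" for x n
  proof -
    have "L2_norm_on M (H (G n)) \<le> 1" using contr[OF G[of n]] G_le[of n] by simp
    then show ?thesis
      using H_bound[OF H_L2[OF G[of n]] x] mult_left_mono[OF _ row_nonneg[of x], of "L2_norm_on M (H (G n))" 1]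
      by simp
  qed
  have dist: "(\<integral>x. (F (r n) x - H (G n) x)\<^sup>2 \<partial>M) \<le> 2 - 2 * (L2_norm_on M (G n))\<^sup>2" for n
  proof -
    note FL = F[of "r n"] and HL = H_L2[OF G[of n]]
    have "(\<integral>x. (F (r n) x - H (G n) x)\<^sup>2 \<partial>M)
      = (\<integral>x. (F (r n) x)\<^sup>2 - 2 * (F (r n) x * H (G n) x) + (H (G n) x)\<^sup>2 \<partial>M)"
      by (simp add: power2_diff algebra_simps)
    also have "\<dots> = (L2_norm_on M (F (r n)))\<^sup>2 - 2 * (\<integral>x. F (r n) x * H (G n) x \<partial>M)
        + (L2_norm_on M (H (G n)))\<^sup>2"
      using L2_mult_integrable[OF FL HL] L2_integrable[OF FL] L2_integrable[OF HL]
      by (simp add: L2_norm_on_square)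
    also have "(\<integral>x. F (r n) x * H (G n) x \<partial>M) = (L2_norm_on M (G n))\<^sup>2"
      using H_self_adjoint[OF FL G[of n]] by (simp add: G_def L2_norm_on_square flip: power2_eq_square)
    also have "(L2_norm_on M (H (G n)))\<^sup>2 \<le> 1"
      using contr[OF G[of n]] G_le[of n] by (simp add: power_le_one)
    finally show ?thesis by (simp add: F1)
  qed
  \<comment> \<open>The sequence \<open>F (r n)\<close> need not converge; only its image
    \<open>G n\<close> does. Applying the contraction \<open>H\<close> to
    \<open>F (r n) - H (G n)\<close> moves the estimate to \<open>G n - H (H (G n))\<close>.\<close>
  have "(\<integral>x. (G n x - H (H (G n)) x)\<^sup>2 \<partial>M) \<le> 2 - 2 * (L2_norm_on M (G n))\<^sup>2" for n
  proof -
    have D: "(\<lambda>x. F (r n) x - H (G n) x) \<in> L2_space M" by (rule L2_diff[OF F H_L2[OF G]])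
    have "(\<integral>x. (G n x - H (H (G n)) x)\<^sup>2 \<partial>M) = (\<integral>x. (H (\<lambda>x. F (r n) x - H (G n) x) x)\<^sup>2 \<partial>M)"
    proof (rule Bochner_Integration.integral_cong[OF refl])
      fix x assume "x \<in> space M"
      from H_diff[OF F H_L2[OF G] this]
      have "H (\<lambda>x. F (r n) x - H (G n) x) x = H (F (r n)) x - H (H (G n)) x" .
      then show "(G n x - H (H (G n)) x)\<^sup>2 = (H (\<lambda>x. F (r n) x - H (G n) x) x)\<^sup>2"
        by (simp add: G_def)
    qed
    also have "\<dots> \<le> (\<integral>x. (F (r n) x - H (G n) x)\<^sup>2 \<partial>M)"
      using power_mono[OF contr[OF D] L2_norm_on_nonneg, of 2] by (simp only: L2_norm_on_square)
    finally show ?thesis using dist[of n] by simp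
  qed
  moreover have "(\<lambda>n. \<integral>x. (G n x - H (H (G n)) x)\<^sup>2 \<partial>M) \<longlonglongrightarrow> (\<integral>x. (h x - H (H h) x)\<^sup>2 \<partial>M)"
  proof (rule sq_lim[OF _ _ L2_scale[OF row_L2, of 2]])
    show "\<bar>G n x - H (H (G n)) x\<bar> \<le> 2 * row x" if "x \<in> space M" for x n
      using Gb[OF that, of n] HHGb[OF that, of n] by linarith
  qed (use lim' HHG in \<open>auto intro!: tendsto_diff\<close>)
  moreover have "(\<lambda>n. 2 - 2 * (L2_norm_on M (G n))\<^sup>2) \<longlonglongrightarrow> 2 - 2 * 1\<^sup>2"
    by (intro tendsto_intros normG)
  ultimately have "(\<integral>x. (h x - H (H h) x)\<^sup>2 \<partial>M) \<le> 2 - 2 * 1\<^sup>2"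
    by (intro LIMSEQ_le[where X = "\<lambda>n. \<integral>x. (G n x - H (H (G n)) x)\<^sup>2 \<partial>M"]) auto
  then have "L2_norm_on M (\<lambda>x. h x - H (H h) x) = 0"
    by (simp add: L2_norm_on_def order_antisym)
  from L2_norm_on_eq_0[OF L2_diff[OF h H_L2[OF H_L2[OF h]]] this]
  have "AE x in M. H (H h) x = h x" by auto
  from inj[OF h this] have "L2_norm_on M h = 0"
    unfolding L2_norm_on_def by (subst integral_cong_AE[where g = "\<lambda>_. 0"]) auto
  then show False using h1 by simp
qed

end

section \<open>Bessel's inequality for the Fourier transform\<close>

text \<open>The characteristic function of the standard normal law, rescaled. Writing the result as
  2 pi times a probability density makes visible the mass 2 pi that becomes the constant in Bessel's
  inequality.\<close>

lemma gaussian_fourier: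
  assumes s: "s > 0"
  shows "(LBINT x. complex_of_real (exp (- (s * x)\<^sup>2 / 2)) * iexp (x * u)) =
    complex_of_real (2 * pi * normal_density 0 s u)"
proof -
  have "complex_of_real (exp (- ((u / s)\<^sup>2) / 2)) = (LINT x|std_normal_distribution. iexp (u / s * x))"
    using fun_cong[OF char_std_normal_distribution, of "u / s"] by (simp add: char_def)
  also have "\<dots> = (LBINT x. std_normal_density x *\<^sub>R iexp (u / s * x))"
    by (subst integral_density) auto
  also have "\<dots> = \<bar>s\<bar> *\<^sub>R (LBINT x. std_normal_density (0 + s * x) *\<^sub>R iexp (u / s * (0 + s * x)))"
    by (rule lborel_integral_real_affine) (use s in auto)
  also have "(\<lambda>x. std_normal_density (0 + s * x) *\<^sub>R iexp (u / s * (0 + s * x))) =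
     (\<lambda>x. complex_of_real (1 / sqrt (2 * pi)) *
        (complex_of_real (exp (- (s * x)\<^sup>2 / 2)) * iexp (x * u)))"
    using s by (auto simp: std_normal_density_def scaleR_conv_of_real fun_eq_iff mult_ac)
  finally have *: "complex_of_real (exp (- ((u / s)\<^sup>2) / 2)) =
      complex_of_real (s / sqrt (2 * pi)) *
      (LBINT x. complex_of_real (exp (- (s * x)\<^sup>2 / 2)) * iexp (x * u))"
    using s by (simp add: scaleR_conv_of_real)
  have "2 * pi * normal_density 0 s u = sqrt (2 * pi) / s * exp (- ((u / s)\<^sup>2) / 2)"
    using s by (simp add: normal_density_def real_sqrt_mult power_divide field_simps)
  then have "complex_of_real (2 * pi * normal_density 0 s u) =
      complex_of_real (sqrt (2 * pi) / s) * complex_of_real (exp (- ((u / s)\<^sup>2) / 2))"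
    by simp
  also have "\<dots> = complex_of_real (sqrt (2 * pi) / s * (s / sqrt (2 * pi))) *
      (LBINT x. complex_of_real (exp (- (s * x)\<^sup>2 / 2)) * iexp (x * u))"
    unfolding * by (simp only: of_real_mult mult.assoc)
  also have "sqrt (2 * pi) / s * (s / sqrt (2 * pi)) = 1" using s by simp
  finally show ?thesis by simp
qed

lemma gaussian_integrable:
  assumes s: "s > (0::real)"
  shows "integrable lborel (\<lambda>x. exp (- (s * x)\<^sup>2 / 2))"
proof -
  have "integrable lborel (\<lambda>x. sqrt (2 * pi) / s * normal_density 0 (1 / s) x)"
    using integrable_normal_density[of "1 / s" 0] s by simp
  also have "(\<lambda>x. sqrt (2 * pi) / s * normal_density 0 (1 / s) x) = (\<lambda>x. exp (- (s * x)\<^sup>2 / 2))"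
    using s by (auto simp: normal_density_def fun_eq_iff real_sqrt_mult power_mult_distrib power_divide field_simps real_sqrt_divide)
  finally show ?thesis .
qed

lemma integrable_pair_mult:
  fixes f :: "'a \<Rightarrow> complex" and g :: "'b \<Rightarrow> complex"
  assumes A: "sigma_finite_measure A" and B: "sigma_finite_measure B"
    and f: "integrable A f" and g: "integrable B g"
  shows "integrable (A \<Otimes>\<^sub>M B) (\<lambda>(x, y). f x * g y)"
proof -
  interpret pair_sigma_finite A B using A B by (simp add: pair_sigma_finite_def)
  note [measurable] = borel_measurable_integrable[OF f] borel_measurable_integrable[OF g]
  show ?thesis
  proof (rule Fubini_integrable)
    show "(\<lambda>(x, y). f x * g y) \<in> borel_measurable (A \<Otimes>\<^sub>M B)" by measurable
    show "integrable A (\<lambda>x. \<integral>y. norm (case (x, y) of (x, y) \<Rightarrow> f x * g y) \<partial>B)"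
      using f by (simp add: norm_mult)
    show "AE x in A. integrable B (\<lambda>y. case (x, y) of (x, y) \<Rightarrow> f x * g y)"
      using g by simp
  qed
qed

text \<open>The Gaussian weight makes the x-integral absolutely convergent. Expanding the squared
  modulus as a double integral in t, t' and integrating over x first leaves the kernel
  \<open>W (t - t')\<close> of mass 2 pi. Bounding |G(t) G(t')| by half the sum of the squares
  (Schur's test) then integrates out one variable at a time.\<close>

lemma bessel_regularized:
  fixes G :: "real \<Rightarrow> complex"
  assumes G: "integrable lborel G" and G2: "integrable lborel (\<lambda>t. (cmod (G t))\<^sup>2)" and s: "s > 0"
  shows "integrable lborel (\<lambda>x. exp (- (s * x)\<^sup>2 / 2) * (cmod (LBINT t. G t * iexp (x * t)))\<^sup>2)"
    and "(LBINT x. exp (- (s * x)\<^sup>2 / 2) * (cmod (LBINT t. G t * iexp (x * t)))\<^sup>2) \<le>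
      2 * pi * (LBINT t. (cmod (G t))\<^sup>2)"
proof -
  define P where "P = (lborel \<Otimes>\<^sub>M lborel :: (real \<times> real) measure)"
  interpret P: sigma_finite_measure P unfolding P_def by (rule sigma_finite_pair_measure) unfold_locales
  interpret LP: pair_sigma_finite "lborel :: real measure" P ..
  define g where "g p = G (fst p) * cnj (G (snd p))" for p
  define w where "w x = exp (- (s * x)\<^sup>2 / 2)" for x
  define Gh where "Gh x = (LBINT t. G t * iexp (x * t))" for x
  define W where "W u = 2 * pi * normal_density 0 s u" for u
  have [measurable]: "G \<in> borel_measurable borel" using borel_measurable_integrable[OF G] by simp
  have [measurable]: "cnj \<in> borel_measurable borel"
    by (intro borel_measurable_continuous_onI continuous_intros)
  have [measurable]: "w \<in> borel_measurable borel" unfolding w_def by measurable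
  have [measurable]: "W \<in> borel_measurable borel" unfolding W_def by measurable
  have [measurable]: "Gh \<in> borel_measurable borel" unfolding Gh_def by measurable
  have w: "integrable lborel w" unfolding w_def by (rule gaussian_integrable[OF s])
  have [simp]: "0 \<le> W u" for u by (simp add: W_def)
  have [simp]: "0 \<le> w x" for x by (simp add: w_def)
  have G_iexp: "integrable lborel (\<lambda>t. G t * iexp (x * t))" for x
    by (rule Bochner_Integration.integrable_bound[OF G]) (auto simp: norm_mult)
  have Gh_bound: "cmod (Gh x) \<le> (LBINT t. cmod (G t))" for x
    unfolding Gh_def using integral_norm_bound[of lborel "\<lambda>t. G t * iexp (x * t)"] by (simp add: norm_mult)
  have int: "integrable lborel (\<lambda>x. w x * (cmod (Gh x))\<^sup>2)"
  proof (rule Bochner_Integration.integrable_bound[OF integrable_mult_left[OF w, of "(LBINT t. cmod (G t))\<^sup>2"]])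
    show "AE x in lborel. norm (w x * (cmod (Gh x))\<^sup>2) \<le> norm (w x * (LBINT t. cmod (G t))\<^sup>2)"
      using Gh_bound by (auto simp: abs_mult intro!: mult_left_mono power_mono)
  qed measurable
  then show "integrable lborel (\<lambda>x. exp (- (s * x)\<^sup>2 / 2) * (cmod (LBINT t. G t * iexp (x * t)))\<^sup>2)"
    by (simp add: w_def Gh_def)
  have cG: "integrable lborel (\<lambda>t. cnj (G t))" using G by simp
  have gi: "integrable P g"
    using integrable_pair_mult[OF _ _ G cG] lborel.sigma_finite_measure_axioms
    by (simp add: P_def g_def[abs_def] case_prod_beta')
  have sq: "complex_of_real ((cmod (Gh x))\<^sup>2) = (\<integral>p. g p * iexp (x * (fst p - snd p)) \<partial>P)" for x
  proof -
    have "complex_of_real ((cmod (Gh x))\<^sup>2) = Gh x * cnj (Gh x)" by (rule complex_norm_square)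
    also have "cnj (Gh x) = (LBINT t. cnj (G t * iexp (x * t)))"
      unfolding Gh_def by (rule Bochner_Integration.integral_cnj[symmetric])
    also have "Gh x * \<dots> = (LBINT t. (LBINT t'. (G t * iexp (x * t)) * cnj (G t' * iexp (x * t'))))"
      by (simp add: Gh_def)
    also have "\<dots> = (\<integral>p. (case p of (t, t') \<Rightarrow> (G t * iexp (x * t)) * cnj (G t' * iexp (x * t'))) \<partial>P)"
      unfolding P_def
      by (subst lborel_pair.integral_fst'[symmetric])
        (use integrable_pair_mult[OF _ _ G_iexp integrable_cnj[OF G_iexp]] lborel.sigma_finite_measure_axioms in auto)
    also have "\<dots> = (\<integral>p. g p * iexp (x * (fst p - snd p)) \<partial>P)"
    proof (rule Bochner_Integration.integral_cong[OF refl])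
      fix p :: "real \<times> real"
      obtain t t' where p: "p = (t, t')" by force
      have "cnj (iexp (x * t')) = iexp (- (x * t'))" by (simp add: exp_cnj)
      then have "iexp (x * t) * cnj (iexp (x * t')) = iexp (x * t) * iexp (- (x * t'))" by simp
      also have "\<dots> = iexp (x * (t - t'))"
        by (simp add: algebra_simps flip: exp_add)
      finally have "iexp (x * t) * cnj (iexp (x * t')) = iexp (x * (t - t'))" .
      then have "G t * cnj (G t') * (iexp (x * t) * cnj (iexp (x * t'))) = G t * cnj (G t') * iexp (x * (t - t'))"
        by simp
      then show "(case p of (t, t') \<Rightarrow> (G t * iexp (x * t)) * cnj (G t' * iexp (x * t'))) =
         g p * iexp (x * (fst p - snd p))"
        unfolding p g_def case_prod_conv fst_conv snd_conv complex_cnj_mult by (simp only: mult_ac)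
    qed
    finally show ?thesis .
  qed
  have int3: "integrable (lborel \<Otimes>\<^sub>M P) (\<lambda>(x, p). complex_of_real (w x) * (g p * iexp (x * (fst p - snd p))))"
  proof (rule Bochner_Integration.integrable_bound)
    show "integrable (lborel \<Otimes>\<^sub>M P) (\<lambda>(x, p). complex_of_real (w x) * g p)"
      by (rule integrable_pair_mult) (use w gi lborel.sigma_finite_measure_axioms P.sigma_finite_measure_axioms in auto)
    show "(\<lambda>(x, p). complex_of_real (w x) * (g p * iexp (x * (fst p - snd p)))) \<in> borel_measurable (lborel \<Otimes>\<^sub>M P)"
      unfolding P_def g_def by measurable
  qed (auto simp: norm_mult)
  have "complex_of_real (LBINT x. w x * (cmod (Gh x))\<^sup>2) =
      (LBINT x. complex_of_real (w x) * complex_of_real ((cmod (Gh x))\<^sup>2))"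
    by (simp flip: integral_complex_of_real)
  also have "\<dots> = (LBINT x. (\<integral>p. complex_of_real (w x) * (g p * iexp (x * (fst p - snd p))) \<partial>P))"
    by (simp only: sq integral_mult_right_zero)
  also have "\<dots> = (\<integral>p. (LBINT x. complex_of_real (w x) * (g p * iexp (x * (fst p - snd p)))) \<partial>P)"
    using LP.Fubini_integral[OF int3] by simp
  also have "\<dots> = (\<integral>p. g p * complex_of_real (W (fst p - snd p)) \<partial>P)"
  proof (rule Bochner_Integration.integral_cong[OF refl])
    fix p
    have "(LBINT x. complex_of_real (w x) * (g p * iexp (x * (fst p - snd p)))) =
        g p * (LBINT x. complex_of_real (w x) * iexp (x * (fst p - snd p)))"
      by (simp add: mult.left_commute)
    then show "(LBINT x. complex_of_real (w x) * (g p * iexp (x * (fst p - snd p)))) =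
        g p * complex_of_real (W (fst p - snd p))"
      using gaussian_fourier[OF s, of "fst p - snd p"] by (simp only: w_def W_def)
  qed
  finally have main: "complex_of_real (LBINT x. w x * (cmod (Gh x))\<^sup>2) =
      (\<integral>p. g p * complex_of_real (W (fst p - snd p)) \<partial>P)" .
  have Wint: "integrable lborel (\<lambda>t'. W (t - t'))" "(LBINT t'. W (t - t')) = 2 * pi" for t
  proof -
    have 1: "integrable lborel W" "(LBINT t'. W t') = 2 * pi"
      using integrable_normal_density[OF s, of 0] integral_normal_density[OF s, of 0]
      by (auto simp: W_def[abs_def])
    show "integrable lborel (\<lambda>t'. W (t - t'))"
      using lborel_integrable_real_affine[OF 1(1), of "-1" t] by simp
    show "(LBINT t'. W (t - t')) = 2 * pi"
      using lborel_integral_real_affine[of "-1" W t] 1(2) by simp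
  qed
  have half: "integrable P (\<lambda>(t, t'). (cmod (G t))\<^sup>2 * W (t - t'))"
    unfolding P_def
  proof (rule lborel_pair.Fubini_integrable)
    show "integrable lborel (\<lambda>x. LBINT y. norm (case (x, y) of (t, t') \<Rightarrow> (cmod (G t))\<^sup>2 * W (t - t')))"
      using G2 Wint by (simp add: abs_mult)
    show "AE x in lborel. integrable lborel (\<lambda>y. case (x, y) of (t, t') \<Rightarrow> (cmod (G t))\<^sup>2 * W (t - t'))"
      using Wint by simp
  qed measurable
  have half_val: "(\<integral>p. (case p of (t, t') \<Rightarrow> (cmod (G t))\<^sup>2 * W (t - t')) \<partial>P) = 2 * pi * (LBINT t. (cmod (G t))\<^sup>2)"
    using lborel_pair.integral_fst'[OF half[unfolded P_def]] Wint by (simp add: P_def mult.commute)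
  have W_sym: "W (t - t') = W (t' - t)" for t t'
    by (simp add: W_def normal_density_def power2_commute)
  have half': "integrable P (\<lambda>(t, t'). (cmod (G t'))\<^sup>2 * W (t - t'))"
    using lborel_pair.integrable_product_swap[OF half[unfolded P_def]]
    unfolding P_def by (simp add: case_prod_beta' W_sym[of "snd x" "fst x" for x])
  have half_val': "(\<integral>p. (case p of (t, t') \<Rightarrow> (cmod (G t'))\<^sup>2 * W (t - t')) \<partial>P) = 2 * pi * (LBINT t. (cmod (G t))\<^sup>2)"
    using lborel_pair.integral_product_swap[of "\<lambda>(t, t'). (cmod (G t))\<^sup>2 * W (t - t')"] half_val half
    unfolding P_def by (simp add: case_prod_beta' W_sym[of "snd x" "fst x" for x])
  have "(LBINT x. w x * (cmod (Gh x))\<^sup>2) = cmod (complex_of_real (LBINT x. w x * (cmod (Gh x))\<^sup>2))"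
    by (simp add: Bochner_Integration.integral_nonneg)
  also have "\<dots> \<le> (\<integral>p. cmod (g p * complex_of_real (W (fst p - snd p))) \<partial>P)"
    unfolding main by (rule integral_norm_bound)
  also have "\<dots> \<le> (\<integral>p. 1/2 * (case p of (t, t') \<Rightarrow> (cmod (G t))\<^sup>2 * W (t - t'))
      + 1/2 * (case p of (t, t') \<Rightarrow> (cmod (G t'))\<^sup>2 * W (t - t')) \<partial>P)"
  proof (rule integral_mono')
    show "integrable P (\<lambda>p. 1/2 * (case p of (t, t') \<Rightarrow> (cmod (G t))\<^sup>2 * W (t - t'))
      + 1/2 * (case p of (t, t') \<Rightarrow> (cmod (G t'))\<^sup>2 * W (t - t')))"
      using half half' by simp
    fix p :: "real \<times> real"
    obtain t t' where p: "p = (t, t')" by force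
    have "2 * (cmod (G t) * cmod (G t')) \<le> (cmod (G t))\<^sup>2 + (cmod (G t'))\<^sup>2"
      using sum_squares_bound[of "cmod (G t)" "cmod (G t')"] by simp
    then have "cmod (G t) * cmod (G t') * W (t - t') \<le> ((cmod (G t))\<^sup>2 + (cmod (G t'))\<^sup>2) / 2 * W (t - t')"
      by (intro mult_right_mono) auto
    then show "cmod (g p * complex_of_real (W (fst p - snd p))) \<le> 1/2 * (case p of (t, t') \<Rightarrow> (cmod (G t))\<^sup>2 * W (t - t'))
      + 1/2 * (case p of (t, t') \<Rightarrow> (cmod (G t'))\<^sup>2 * W (t - t'))"
      by (simp add: p g_def norm_mult field_simps)
    show "0 \<le> 1/2 * (case p of (t, t') \<Rightarrow> (cmod (G t))\<^sup>2 * W (t - t'))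
      + 1/2 * (case p of (t, t') \<Rightarrow> (cmod (G t'))\<^sup>2 * W (t - t'))" by (simp add: p)
  qed
  also have "\<dots> = 2 * pi * (LBINT t. (cmod (G t))\<^sup>2)"
    using half half' half_val half_val' by simp
  finally show "(LBINT x. exp (- (s * x)\<^sup>2 / 2) * (cmod (LBINT t. G t * iexp (x * t)))\<^sup>2) \<le>
      2 * pi * (LBINT t. (cmod (G t))\<^sup>2)"
    by (simp only: w_def Gh_def)
qed

text \<open>Fatou's lemma as the weight flattens to 1. The nonnegative integral makes finiteness
  part of the conclusion.\<close>

lemma bessel_inequality:
  fixes G :: "real \<Rightarrow> complex"
  assumes G: "integrable lborel G" and G2: "integrable lborel (\<lambda>t. (cmod (G t))\<^sup>2)"
  shows "(\<integral>\<^sup>+x. ennreal ((cmod (LBINT t. G t * iexp (x * t)))\<^sup>2) \<partial>lborel) \<le>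
    ennreal (2 * pi * (LBINT t. (cmod (G t))\<^sup>2))"
proof -
  define Gh where "Gh x = (LBINT t. G t * iexp (x * t))" for x
  define f where "f n x = exp (- (inverse (real (Suc n)) * x)\<^sup>2 / 2) * (cmod (Gh x))\<^sup>2" for n x
  have [measurable]: "G \<in> borel_measurable borel" using borel_measurable_integrable[OF G] by simp
  have [measurable]: "Gh \<in> borel_measurable borel" unfolding Gh_def by measurable
  have lim: "(\<lambda>n. ennreal (f n x)) \<longlonglongrightarrow> ennreal ((cmod (Gh x))\<^sup>2)" for x
  proof -
    have "(\<lambda>n. f n x) \<longlonglongrightarrow> exp (- (0 * x)\<^sup>2 / 2) * (cmod (Gh x))\<^sup>2"
      unfolding f_def by (intro tendsto_intros LIMSEQ_inverse_real_of_nat) simp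
    then show ?thesis by (intro tendsto_ennrealI) simp
  qed
  have "(\<integral>\<^sup>+x. ennreal ((cmod (Gh x))\<^sup>2) \<partial>lborel) = (\<integral>\<^sup>+x. liminf (\<lambda>n. ennreal (f n x)) \<partial>lborel)"
    by (rule nn_integral_cong) (metis lim_imp_Liminf lim trivial_limit_sequentially)
  also have "\<dots> \<le> liminf (\<lambda>n. \<integral>\<^sup>+x. ennreal (f n x) \<partial>lborel)"
    by (rule nn_integral_liminf) (unfold f_def, measurable)
  also have "\<dots> \<le> ennreal (2 * pi * (LBINT t. (cmod (G t))\<^sup>2))"
  proof (rule Liminf_le[OF _ always_eventually], simp, rule allI)
    fix n
    note b = bessel_regularized[OF G G2, of "inverse (real (Suc n))"]
    have "(\<integral>\<^sup>+x. ennreal (f n x) \<partial>lborel) = ennreal (LBINT x. f n x)"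
      by (rule nn_integral_eq_integral) (use b in \<open>auto simp: f_def Gh_def\<close>)
    then show "(\<integral>\<^sup>+x. ennreal (f n x) \<partial>lborel) \<le> ennreal (2 * pi * (LBINT t. (cmod (G t))\<^sup>2))"
      using b by (auto simp: f_def Gh_def intro!: ennreal_leI)
  qed
  finally show ?thesis by (simp add: Gh_def)
qed

section \<open>The Airy function by contour shift\<close>

lemma gaussian_exp_integrable:
  assumes e: "\<eta> > (0::real)"
  shows "integrable lborel (\<lambda>t. exp (r * t - \<eta> * t\<^sup>2))"
proof -
  \<comment> \<open>Completing the square: r t - \<eta> t^2 = r^2/(4 \<eta>) - (t - \<mu>)^2/(2
    \<sigma>^2).\<close>
  define \<sigma> where "\<sigma> = sqrt (1 / (2 * \<eta>))"
  define \<mu> where "\<mu> = r / (2 * \<eta>)"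
  have s2: "\<sigma>\<^sup>2 = 1 / (2 * \<eta>)" and s0: "\<sigma> > 0" using e by (auto simp: \<sigma>_def)
  have "integrable lborel (\<lambda>t. (sqrt (2 * pi * \<sigma>\<^sup>2) * exp (r\<^sup>2 / (4 * \<eta>))) * normal_density \<mu> \<sigma> t)"
    using s0 by simp
  also have "(\<lambda>t. (sqrt (2 * pi * \<sigma>\<^sup>2) * exp (r\<^sup>2 / (4 * \<eta>))) * normal_density \<mu> \<sigma> t) = (\<lambda>t. exp (r * t - \<eta> * t\<^sup>2))"
  proof
    fix t
    have "r\<^sup>2 / (4 * \<eta>) + - (t - \<mu>)\<^sup>2 / (2 * \<sigma>\<^sup>2) = r * t - \<eta> * t\<^sup>2"
      unfolding s2 using e by (simp add: \<mu>_def field_simps power2_eq_square)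
    then have "exp (r\<^sup>2 / (4 * \<eta>)) * exp (- (t - \<mu>)\<^sup>2 / (2 * \<sigma>\<^sup>2)) = exp (r * t - \<eta> * t\<^sup>2)"
      by (simp only: flip: exp_add)
    moreover have "sqrt (2 * pi * \<sigma>\<^sup>2) \<noteq> 0" using s0 by simp
    ultimately show "(sqrt (2 * pi * \<sigma>\<^sup>2) * exp (r\<^sup>2 / (4 * \<eta>))) * normal_density \<mu> \<sigma> t = exp (r * t - \<eta> * t\<^sup>2)"
      by (simp add: normal_density_def field_simps)
  qed
  finally show ?thesis .
qed

lemma gaussian_exp_abs_integrable:
  assumes "\<eta> > (0::real)"
  shows "integrable lborel (\<lambda>t. exp (r * \<bar>t\<bar> - \<eta> * t\<^sup>2))"
proof (rule Bochner_Integration.integrable_bound)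
  show "integrable lborel (\<lambda>t. exp (r * t - \<eta> * t\<^sup>2) + exp ((- r) * t - \<eta> * t\<^sup>2))"
    using gaussian_exp_integrable[OF assms] by (intro Bochner_Integration.integrable_add) blast+
  show "AE t in lborel. norm (exp (r * \<bar>t\<bar> - \<eta> * t\<^sup>2)) \<le> norm (exp (r * t - \<eta> * t\<^sup>2) + exp ((- r) * t - \<eta> * t\<^sup>2))"
  proof (rule AE_I2)
    fix t :: real
    show "norm (exp (r * \<bar>t\<bar> - \<eta> * t\<^sup>2)) \<le> norm (exp (r * t - \<eta> * t\<^sup>2) + exp ((- r) * t - \<eta> * t\<^sup>2))"
      by (cases "t < 0") (simp_all add: abs_of_pos add_pos_pos)
  qed
qed measurable

section \<open>The contour-shifted Airy integral\<close>

definition airy_exp :: "real \<Rightarrow> complex \<Rightarrow> complex" where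
  "airy_exp x z = exp (\<i> * (z ^ 3 / 3 + of_real x * z))"

text \<open>The term \<open>- t\<^sup>2 * s\<close> is the gain from the shift: the purely
  oscillating integrand becomes Gaussian at every positive height s.\<close>

lemma norm_airy_exp: "cmod (airy_exp x (Complex t s)) = exp (s ^ 3 / 3 - t\<^sup>2 * s - x * s)"
proof -
  have "Complex t s ^ 3 = Complex (t ^ 3 - 3 * t * s\<^sup>2) (3 * t\<^sup>2 * s - s ^ 3)"
    by (simp add: complex_eq_iff power3_eq_cube power2_eq_square algebra_simps)
  then show ?thesis
    by (simp add: airy_exp_def field_simps)
qed

text \<open>One global primitive expresses each side of the rectangle as a difference of corner
  values, so that comparing two contours becomes subtraction.\<close>

lemma airy_exp_primitive:
  obtains P where "\<And>z. (P has_field_derivative airy_exp x z) (at z)"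
proof -
  have "airy_exp x holomorphic_on UNIV"
    unfolding airy_exp_def by (intro holomorphic_intros) auto
  from holomorphic_convex_primitive'[OF convex_UNIV open_UNIV this]
  show ?thesis using that by (metis UNIV_I)
qed

lemma airy_contour_horizontal:
  assumes P: "\<And>z. (P has_field_derivative airy_exp x z) (at z)" and "a \<le> b"
  shows "((\<lambda>t. airy_exp x (Complex t s)) has_integral (P (Complex b s) - P (Complex a s))) {a..b}"
proof (rule fundamental_theorem_of_calculus[OF \<open>a \<le> b\<close>])
  fix t
  have "((\<lambda>t. of_real t + \<i> * of_real s) has_vector_derivative 1) (at t)"
    by (auto intro!: derivative_eq_intros simp: has_vector_derivative_def scaleR_conv_of_real fun_eq_iff)
  from field_vector_diff_chain_at[OF this P]
  have "((\<lambda>t. P (Complex t s)) has_vector_derivative airy_exp x (Complex t s)) (at t)"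
    by (simp add: comp_def Complex_eq)
  then show "((\<lambda>t. P (Complex t s)) has_vector_derivative airy_exp x (Complex t s)) (at t within {a..b})"
    by (rule has_vector_derivative_at_within)
qed

text \<open>At the foot of the side the integrand has modulus 1, so the supremum over the side does
  not decay. What decays is the integral of exp(-R^2 s) over s, at most 1/R^2. The bound covers both
  vertical sides, R being of either sign.\<close>

lemma airy_contour_vertical:
  assumes P: "\<And>z. (P has_field_derivative airy_exp x z) (at z)" and e: "\<eta> > 0" and R: "R \<noteq> 0"
  shows "cmod (P (Complex R \<eta>) - P (Complex R 0)) \<le> exp (\<eta> ^ 3 / 3 + \<bar>x\<bar> * \<eta>) / R\<^sup>2"
proof -
  define C where "C = exp (\<eta> ^ 3 / 3 + \<bar>x\<bar> * \<eta>)"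
  have I: "((\<lambda>s. \<i> * airy_exp x (Complex R s)) has_integral (P (Complex R \<eta>) - P (Complex R 0))) {0..\<eta>}"
  proof (rule fundamental_theorem_of_calculus)
    fix s
    have "((\<lambda>s. of_real R + \<i> * of_real s) has_vector_derivative \<i>) (at s)"
      by (auto intro!: derivative_eq_intros simp: has_vector_derivative_def scaleR_conv_of_real fun_eq_iff)
    from field_vector_diff_chain_at[OF this P]
    have "((\<lambda>s. P (Complex R s)) has_vector_derivative \<i> * airy_exp x (Complex R s)) (at s)"
      by (simp add: comp_def Complex_eq)
    then show "((\<lambda>s. P (Complex R s)) has_vector_derivative \<i> * airy_exp x (Complex R s)) (at s within {0..\<eta>})"
      by (rule has_vector_derivative_at_within)
  qed (use e in simp)
  have J: "((\<lambda>s. C * exp (- R\<^sup>2 * s)) has_integral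
      (- C * exp (- R\<^sup>2 * \<eta>) / R\<^sup>2 - (- C * exp (- R\<^sup>2 * 0) / R\<^sup>2))) {0..\<eta>}"
  proof (rule fundamental_theorem_of_calculus)
    fix s
    have "((\<lambda>s. - C * exp (- R\<^sup>2 * s) / R\<^sup>2) has_real_derivative C * exp (- R\<^sup>2 * s)) (at s within {0..\<eta>})"
      using R by (auto intro!: derivative_eq_intros simp: power2_eq_square power4_eq_xxxx)
    then show "((\<lambda>s. - C * exp (- R\<^sup>2 * s) / R\<^sup>2) has_vector_derivative C * exp (- R\<^sup>2 * s)) (at s within {0..\<eta>})"
      by (rule has_real_derivative_iff_has_vector_derivative[THEN iffD1])
  qed (use e in simp)
  have "cmod (P (Complex R \<eta>) - P (Complex R 0)) = cmod (integral {0..\<eta>} (\<lambda>s. \<i> * airy_exp x (Complex R s)))"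
    using integral_unique[OF I] by simp
  also have "\<dots> \<le> integral {0..\<eta>} (\<lambda>s. C * exp (- R\<^sup>2 * s))"
  proof (rule integral_norm_bound_integral)
    fix s assume s: "s \<in> {0..\<eta>}"
    have "s ^ 3 \<le> \<eta> ^ 3" using s by (intro power_mono) auto
    moreover have "- x * s \<le> \<bar>x\<bar> * \<eta>"
    proof -
      have "- x * s \<le> \<bar>x\<bar> * s" using s by (intro mult_right_mono) auto
      also have "\<dots> \<le> \<bar>x\<bar> * \<eta>" using s by (intro mult_left_mono) auto
      finally show ?thesis .
    qed
    ultimately have "s ^ 3 / 3 - R\<^sup>2 * s - x * s \<le> (\<eta> ^ 3 / 3 + \<bar>x\<bar> * \<eta>) + (- R\<^sup>2 * s)"
      by simp
    then have "exp (s ^ 3 / 3 - R\<^sup>2 * s - x * s) \<le> C * exp (- R\<^sup>2 * s)"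
      unfolding C_def by (simp only: flip: exp_add) simp
    then show "cmod (\<i> * airy_exp x (Complex R s)) \<le> C * exp (- R\<^sup>2 * s)"
      by (simp add: norm_mult norm_airy_exp)
  qed (use I J in \<open>auto simp: integrable_on_def\<close>)
  also have "\<dots> = C / R\<^sup>2 - C * exp (- R\<^sup>2 * \<eta>) / R\<^sup>2"
    using integral_unique[OF J] by simp
  also have "\<dots> \<le> C / R\<^sup>2" by (simp add: C_def)
  finally show ?thesis by (simp add: C_def)
qed

lemma airy_exp_integrable:
  assumes "\<eta> > 0"
  shows "integrable lborel (\<lambda>t. airy_exp x (Complex t \<eta>))"
proof (rule Bochner_Integration.integrable_bound)
  show "integrable lborel (\<lambda>t. exp (\<eta> ^ 3 / 3 - x * \<eta>) * exp (0 * t - \<eta> * t\<^sup>2))"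
    by (intro integrable_mult_right gaussian_exp_integrable assms)
  show "(\<lambda>t. airy_exp x (Complex t \<eta>)) \<in> borel_measurable lborel"
    unfolding airy_exp_def Complex_eq
    by (auto intro!: borel_measurable_continuous_onI continuous_intros)
  show "AE t in lborel. norm (airy_exp x (Complex t \<eta>)) \<le> norm (exp (\<eta> ^ 3 / 3 - x * \<eta>) * exp (0 * t - \<eta> * t\<^sup>2))"
    by (simp add: norm_airy_exp algebra_simps flip: exp_add)
qed

text \<open>Pairing t with -t shows that twice the cosine integral up to R is the integral of
  \<open>airy_exp\<close> over the real segment from -R to R. Moving that segment to height \<eta>
  costs only the two vertical sides. The height stays free: a large one gives decay, a small one the
  contraction estimate.\<close>

lemma Airy_integral:
  assumes e: "\<eta> > 0"
  shows "complex_of_real (Airy x) = (LBINT t. airy_exp x (Complex t \<eta>)) / (2 * of_real pi)"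
proof -
  define I where "I = (LBINT t. airy_exp x (Complex t \<eta>))"
  define c where "c R = integral {0..R} (\<lambda>t. cos (t ^ 3 / 3 + x * t))" for R
  obtain P where P: "\<And>z. (P has_field_derivative airy_exp x z) (at z)"
    using airy_exp_primitive by blast
  have c: "complex_of_real (2 * c R) = P (Complex R 0) - P (Complex (- R) 0)" if R: "R > 0" for R
  proof -
    have A: "((\<lambda>t. airy_exp x (Complex t 0)) has_integral (P (Complex R 0) - P (Complex 0 0))) {0..R}"
      by (rule airy_contour_horizontal[OF P]) (use R in simp)
    have "((\<lambda>t. airy_exp x (Complex t 0)) has_integral (P (Complex 0 0) - P (Complex (-R) 0))) {-R..-0}"
      using airy_contour_horizontal[OF P, of "-R" 0 0] R by simp
    then have B: "((\<lambda>t. airy_exp x (Complex (-t) 0)) has_integral (P (Complex 0 0) - P (Complex (-R) 0))) {0..R}"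
      using has_integral_reflect_real[of "\<lambda>t. airy_exp x (Complex (-t) 0)" _ R 0] by simp
    have AB: "airy_exp x (Complex t 0) + airy_exp x (Complex (-t) 0) = complex_of_real (2 * cos (t ^ 3 / 3 + x * t))" for t
    proof -
      have 1: "airy_exp x (Complex t 0) = cis (t ^ 3 / 3 + x * t)"
        by (simp add: airy_exp_def cis_conv_exp Complex_eq)
      have 2: "airy_exp x (Complex (-t) 0) = cis (- (t ^ 3 / 3 + x * t))"
        by (simp add: airy_exp_def cis_conv_exp Complex_eq power3_eq_cube)
      have "cis u + cis (- u) = complex_of_real (2 * cos u)" for u by (simp add: complex_eq_iff)
      then show ?thesis unfolding 1 2 .
    qed
    have S: "((\<lambda>t. complex_of_real (2 * cos (t ^ 3 / 3 + x * t))) has_integral (P (Complex R 0) - P (Complex (-R) 0))) {0..R}"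
      using has_integral_add[OF A B] unfolding AB by simp
    have "(\<lambda>t. cos (t ^ 3 / 3 + x * t)) integrable_on {0..R}"
      by (intro integrable_continuous_real continuous_intros) auto
    then have "((\<lambda>t. cos (t ^ 3 / 3 + x * t)) has_integral c R) {0..R}"
      unfolding c_def by (rule integrable_integral)
    then have "((\<lambda>t. 2 * cos (t ^ 3 / 3 + x * t)) has_integral 2 * c R) {0..R}"
      by (rule has_integral_mult_right)
    then have "((\<lambda>t. complex_of_real (2 * cos (t ^ 3 / 3 + x * t))) has_integral complex_of_real (2 * c R)) {0..R}"
      by (rule has_integral_of_real)
    then show ?thesis using S has_integral_unique by blast
  qed
  define J where "J R = P (Complex R \<eta>) - P (Complex (- R) \<eta>)" for R
  have J: "J R = (LBINT t. indicator {-R..R} t *\<^sub>R airy_exp x (Complex t \<eta>))" if R: "R > 0" for R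
  proof -
    have "set_integrable lborel {-R..R} (\<lambda>t. airy_exp x (Complex t \<eta>))"
      unfolding set_integrable_def by (rule integrable_mult_indicator[OF _ airy_exp_integrable[OF e]]) simp
    from set_borel_integral_eq_integral(2)[OF this]
    show ?thesis
      using integral_unique[OF airy_contour_horizontal[OF P, of "-R" R \<eta>]] R
      by (simp add: J_def set_lebesgue_integral_def)
  qed
  have "((\<lambda>R. LBINT t. indicator {-R..R} t *\<^sub>R airy_exp x (Complex t \<eta>)) \<longlongrightarrow> I) at_top"
    unfolding I_def
  proof (rule integral_dominated_convergence_at_top[OF _ _ integrable_norm[OF airy_exp_integrable[OF e]]])
    show "AE t in lborel. ((\<lambda>R. indicator {-R..R} t *\<^sub>R airy_exp x (Complex t \<eta>)) \<longlongrightarrow> airy_exp x (Complex t \<eta>)) at_top"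
    proof (rule AE_I2)
      fix t :: real
      have "\<forall>\<^sub>F R in at_top. indicator {-R..R} t *\<^sub>R airy_exp x (Complex t \<eta>) = airy_exp x (Complex t \<eta>)"
        using eventually_ge_at_top[of "\<bar>t\<bar>"] by eventually_elim (auto simp: indicator_def)
      then show "((\<lambda>R. indicator {-R..R} t *\<^sub>R airy_exp x (Complex t \<eta>)) \<longlongrightarrow> airy_exp x (Complex t \<eta>)) at_top"
        by (rule tendsto_eventually)
    qed
    show "\<forall>\<^sub>F R in at_top. AE t in lborel. norm (indicator {-R..R} t *\<^sub>R airy_exp x (Complex t \<eta>)) \<le> norm (airy_exp x (Complex t \<eta>))"
      by (intro always_eventually allI AE_I2) (auto simp: indicator_def)
  qed (use borel_measurable_integrable[OF airy_exp_integrable[OF e, of x]] in auto)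
  moreover have "\<forall>\<^sub>F R in at_top. (LBINT t. indicator {-R..R} t *\<^sub>R airy_exp x (Complex t \<eta>)) = J R"
    using eventually_gt_at_top[of 0] by eventually_elim (simp add: J)
  ultimately have limJ: "(J \<longlongrightarrow> I) at_top" by (rule Lim_transform_eventually)
  have "((\<lambda>R. complex_of_real (2 * c R) - J R) \<longlongrightarrow> 0) at_top"
  proof (rule Lim_null_comparison)
    define C where "C = exp (\<eta> ^ 3 / 3 + \<bar>x\<bar> * \<eta>)"
    show "\<forall>\<^sub>F R in at_top. norm (complex_of_real (2 * c R) - J R) \<le> 2 * C / R\<^sup>2"
      using eventually_gt_at_top[of 0]
    proof eventually_elim
      case (elim R)
      have "complex_of_real (2 * c R) - J R =
        (P (Complex (- R) \<eta>) - P (Complex (- R) 0)) - (P (Complex R \<eta>) - P (Complex R 0))"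
        using c[OF elim] by (simp add: J_def)
      also have "norm \<dots> \<le> norm (P (Complex (- R) \<eta>) - P (Complex (- R) 0)) + norm (P (Complex R \<eta>) - P (Complex R 0))"
        by (rule norm_triangle_ineq4)
      also have "\<dots> \<le> C / R\<^sup>2 + C / R\<^sup>2"
        using airy_contour_vertical[OF P e, of "-R"] airy_contour_vertical[OF P e, of R] elim
        by (intro add_mono) (auto simp: C_def)
      finally show ?case by simp
    qed
    show "((\<lambda>R. 2 * C / R\<^sup>2) \<longlongrightarrow> 0) at_top"
      by (intro tendsto_divide_0[OF tendsto_const] filterlim_at_top_imp_at_infinity
          filterlim_pow_at_top filterlim_ident) simp
  qed
  from tendsto_add[OF this limJ] have lim: "((\<lambda>R. complex_of_real (2 * c R)) \<longlongrightarrow> I) at_top" by simp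
  have Re: "((\<lambda>R. 2 * c R) \<longlongrightarrow> Re I) at_top" using tendsto_Re[OF lim] by simp
  \<comment> \<open>The truncated integrals at height 0 are real, hence so is the limit I, and the
    complex identity loses nothing by taking real parts.\<close>
  have "((\<lambda>R::real. 0 :: real) \<longlongrightarrow> Im I) at_top" using tendsto_Im[OF lim] by simp
  then have Im: "Im I = 0" by (simp add: tendsto_const_iff)
  have "(c \<longlongrightarrow> Re I / 2) at_top" using tendsto_divide[OF Re tendsto_const[of 2]] by simp
  then have L: "Lim at_top c = Re I / 2" by (intro tendsto_Lim) auto
  have "Airy x = 1 / pi * Lim at_top c" by (simp add: Airy_def c_def[abs_def])
  then have "Airy x = Re I / (2 * pi)" unfolding L by simp
  then show ?thesis using Im by (simp add: complex_eq_iff flip: I_def)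
qed

text \<open>What is left of the integrand at height \<eta> after the factors depending on x are
  removed; it is the Fourier multiplier of the Airy transform.\<close>

definition airy_symbol :: "real \<Rightarrow> real \<Rightarrow> complex" where
  "airy_symbol \<eta> t = airy_exp 0 (Complex t \<eta>)"

lemma norm_airy_symbol: "cmod (airy_symbol \<eta> t) = exp (\<eta> ^ 3 / 3 - \<eta> * t\<^sup>2)"
  by (simp add: airy_symbol_def norm_airy_exp mult.commute)

lemma airy_symbol_integrable: "\<eta> > 0 \<Longrightarrow> integrable lborel (airy_symbol \<eta>)"
  using airy_exp_integrable[of \<eta> 0] by (simp add: airy_symbol_def[abs_def])

lemma airy_symbol_measurable [measurable]: "airy_symbol \<eta> \<in> borel_measurable borel"
  unfolding airy_symbol_def airy_exp_def Complex_eq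
  by (auto intro!: borel_measurable_continuous_onI continuous_intros)

lemma Airy_fourier:
  assumes "\<eta> > 0"
  shows "complex_of_real (Airy x) =
    complex_of_real (exp (- \<eta> * x) / (2 * pi)) * (LBINT t. airy_symbol \<eta> t * iexp (x * t))"
proof -
  have "airy_exp x (Complex t \<eta>) = complex_of_real (exp (- \<eta> * x)) * (airy_symbol \<eta> t * iexp (x * t))" for t
    unfolding airy_symbol_def airy_exp_def exp_of_real[symmetric] exp_add[symmetric] Complex_eq
    by (simp add: algebra_simps)
  then show ?thesis using Airy_integral[OF assms, of x] by simp
qed

text \<open>Exponential decay to the right at any chosen rate; the rate is fixed later to beat
  whatever exponential multiplies \<open>Airy\<close>.\<close>

lemma Airy_bound:
  assumes "\<eta> > 0"
  shows "\<bar>Airy x\<bar> \<le> (LBINT t. cmod (airy_symbol \<eta> t)) / (2 * pi) * exp (- \<eta> * x)"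
proof -
  have "\<bar>Airy x\<bar> = cmod (complex_of_real (Airy x))" by simp
  also have "\<dots> = exp (- \<eta> * x) / (2 * pi) * cmod (LBINT t. airy_symbol \<eta> t * iexp (x * t))"
    unfolding Airy_fourier[OF assms] norm_mult by (simp add: norm_divide)
  also have "\<dots> \<le> exp (- \<eta> * x) / (2 * pi) * (LBINT t. cmod (airy_symbol \<eta> t * iexp (x * t)))"
    by (intro mult_left_mono integral_norm_bound) simp
  finally show ?thesis by (simp add: norm_mult mult.commute)
qed

lemma Airy_measurable [measurable]: "Airy \<in> borel_measurable borel"
proof -
  have "(\<lambda>x. Re (complex_of_real (exp (- 1 * x) / (2 * pi)) * (LBINT t. airy_symbol 1 t * iexp (x * t)))) \<in> borel_measurable borel"
    by measurable
  also have "(\<lambda>x. Re (complex_of_real (exp (- 1 * x) / (2 * pi)) * (LBINT t. airy_symbol 1 t * iexp (x * t)))) = Airy"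
    by (rule ext) (metis Airy_fourier Re_complex_of_real zero_less_one)
  finally show ?thesis .
qed

section \<open>The Airy transform\<close>

text \<open>Termwise integration of the exponential series: all its partial sums are dominated by
  |G(t)| exp(|z||t|), which the Gaussian bound makes integrable. The coefficients \<open>c n\<close>
  are the moments of G up to factorials and powers of i. The second claim is uniform on discs, as
  Montel's theorem requires.\<close>

lemma fourier_entire:
  fixes G :: "real \<Rightarrow> complex"
  assumes meas [measurable]: "G \<in> borel_measurable borel"
    and bound: "\<And>t. cmod (G t) \<le> C * exp (- \<eta> * t\<^sup>2)" and e: "\<eta> > 0"
  shows "(\<lambda>z. LBINT t. G t * exp (\<i> * z * of_real t)) holomorphic_on UNIV"
    and "cmod z \<le> r \<Longrightarrow>
      cmod (LBINT t. G t * exp (\<i> * z * of_real t)) \<le> C * (LBINT t. exp (r * \<bar>t\<bar> - \<eta> * t\<^sup>2))"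
proof -
  define m where "m r t = C * exp (r * \<bar>t\<bar> - \<eta> * t\<^sup>2)" for r t
  have m: "integrable lborel (m r)" for r
    unfolding m_def by (intro integrable_mult_right gaussian_exp_abs_integrable e)
  have Gm: "cmod (G t) * exp (r * \<bar>t\<bar>) \<le> m r t" for r t
  proof -
    have "cmod (G t) * exp (r * \<bar>t\<bar>) \<le> C * exp (- \<eta> * t\<^sup>2) * exp (r * \<bar>t\<bar>)"
      by (intro mult_right_mono bound) simp
    then show ?thesis by (simp add: m_def mult.assoc flip: exp_add)
  qed
  have partial: "(\<Sum>i<N. s ^ i /\<^sub>R fact i) \<le> exp s" if "0 \<le> s" for s :: real and N
    unfolding exp_def
    by (rule sum_le_suminf) (use summable_exp_generic[of s] that in auto)
  have "cmod (LBINT t. G t * exp (\<i> * z * of_real t)) \<le> (LBINT t. m r t)" if z: "cmod z \<le> r" for z r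
  proof -
    have "cmod (LBINT t. G t * exp (\<i> * z * of_real t)) \<le> (LBINT t. cmod (G t * exp (\<i> * z * of_real t)))"
      by (rule integral_norm_bound)
    also have "\<dots> \<le> (LBINT t. m r t)"
    proof (rule integral_mono'[OF m])
      fix t
      have "cmod (exp (\<i> * z * of_real t)) \<le> exp (r * \<bar>t\<bar>)"
      proof -
        have "cmod (exp (\<i> * z * of_real t)) \<le> exp (cmod (\<i> * z * of_real t))" by (rule norm_exp)
        also have "\<dots> \<le> exp (r * \<bar>t\<bar>)" using z by (simp add: norm_mult mult_right_mono)
        finally show ?thesis .
      qed
      then have "cmod (G t) * cmod (exp (\<i> * z * of_real t)) \<le> cmod (G t) * exp (r * \<bar>t\<bar>)"
        by (rule mult_left_mono) simp
      then show "cmod (G t * exp (\<i> * z * of_real t)) \<le> m r t"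
        using Gm[of t r] by (simp add: norm_mult)
      show "0 \<le> m r t" by (rule order_trans[OF _ Gm]) simp
    qed
    finally show ?thesis .
  qed
  then show "cmod z \<le> r \<Longrightarrow>
      cmod (LBINT t. G t * exp (\<i> * z * of_real t)) \<le> C * (LBINT t. exp (r * \<bar>t\<bar> - \<eta> * t\<^sup>2))"
    by (simp add: m_def)
  define c where "c n = (LBINT t. G t * ((\<i> * of_real t) ^ n /\<^sub>R fact n))" for n
  have series: "(\<lambda>n. c n * (z - 0) ^ n) sums (LBINT t. G t * exp (\<i> * z * of_real t))" for z
  proof -
    define u where "u n t = G t * ((\<i> * z * of_real t) ^ n /\<^sub>R fact n)" for n t
    have norm_u: "norm (u n t) = cmod (G t) * ((cmod z * \<bar>t\<bar>) ^ n /\<^sub>R fact n)" for n t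
      by (simp add: u_def norm_mult norm_power)
    have [measurable]: "u n \<in> borel_measurable borel" for n unfolding u_def by measurable
    have part_u: "(\<Sum>i<N. norm (u i t)) \<le> m (cmod z) t" for N t
    proof -
      have "(\<Sum>i<N. norm (u i t)) = cmod (G t) * (\<Sum>i<N. (cmod z * \<bar>t\<bar>) ^ i /\<^sub>R fact i)"
        unfolding norm_u by (rule sum_distrib_left[symmetric])
      also have "\<dots> \<le> cmod (G t) * exp (cmod z * \<bar>t\<bar>)"
        by (intro mult_left_mono partial) auto
      finally show ?thesis using Gm[of t "cmod z"] by simp
    qed
    have u_int: "integrable lborel (u n)" for n
    proof (rule Bochner_Integration.integrable_bound[OF m[of "cmod z"]])
      show "AE t in lborel. norm (u n t) \<le> norm (m (cmod z) t)"
      proof (rule AE_I2)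
        fix t
        have "norm (u n t) \<le> (\<Sum>i<Suc n. norm (u i t))" by (rule member_le_sum) auto
        then show "norm (u n t) \<le> norm (m (cmod z) t)" using part_u[where N = "Suc n" and t = t] by simp
      qed
    qed simp
    have "(\<lambda>n. integral\<^sup>L lborel (u n)) sums (LBINT t. (\<Sum>n. u n t))"
    proof (rule sums_integral[OF u_int])
      show "AE t in lborel. summable (\<lambda>n. norm (u n t))"
        by (intro AE_I2 summableI_nonneg_bounded[OF _ part_u]) simp
      show "summable (\<lambda>n. LBINT t. norm (u n t))"
      proof (rule summableI_nonneg_bounded)
        fix N
        have "(\<Sum>n<N. LBINT t. norm (u n t)) = (LBINT t. (\<Sum>n<N. norm (u n t)))"
          using u_int by (simp add: Bochner_Integration.integral_sum)
        also have "\<dots> \<le> (LBINT t. m (cmod z) t)"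
          by (rule integral_mono[OF _ m part_u]) (use u_int in simp)
        finally show "(\<Sum>n<N. LBINT t. norm (u n t)) \<le> (LBINT t. m (cmod z) t)" .
      qed simp
    qed
    also have "(\<lambda>n. integral\<^sup>L lborel (u n)) = (\<lambda>n. c n * (z - 0) ^ n)"
    proof
      fix n
      have "u n = (\<lambda>t. G t * ((\<i> * of_real t) ^ n /\<^sub>R fact n) * z ^ n)"
        by (auto simp: u_def power_mult_distrib mult_ac)
      then show "integral\<^sup>L lborel (u n) = c n * (z - 0) ^ n" by (simp add: c_def)
    qed
    also have "(\<lambda>t. \<Sum>n. u n t) = (\<lambda>t. G t * exp (\<i> * z * of_real t))"
      unfolding u_def exp_def by (intro ext suminf_mult summable_exp_generic)
    finally show ?thesis .
  qed
  have "(\<lambda>z. LBINT t. G t * exp (\<i> * z * of_real t)) holomorphic_on ball 0 R" for R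
    by (rule power_series_holomorphic) (rule series)
  then have "(\<lambda>z. LBINT t. G t * exp (\<i> * z * of_real t)) field_differentiable (at z)" for z
    by (rule holomorphic_on_imp_differentiable_at[where s = "ball 0 (cmod z + 1)"]) auto
  then show "(\<lambda>z. LBINT t. G t * exp (\<i> * z * of_real t)) holomorphic_on UNIV"
    by (simp add: holomorphic_on_def)
qed

lemma halfline_exp_L2:
  assumes "\<eta> > 0"
  shows "(\<lambda>y. indicator {a<..} y * exp (- \<eta> * (y - a))) \<in> L2_space lborel"
proof -
  have "(\<integral>\<^sup>+y. ennreal (exp (- (2 * \<eta>) * (y - a))) * indicator {a..} y \<partial>lborel)
      = ennreal (0 - - exp (- (2 * \<eta>) * (a - a)) / (2 * \<eta>))"
  proof (rule nn_integral_FTC_atLeast[where F = "\<lambda>y. - exp (- (2 * \<eta>) * (y - a)) / (2 * \<eta>)"])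
    show "((\<lambda>y. - exp (- (2 * \<eta>) * (y - a)) / (2 * \<eta>)) \<longlongrightarrow> 0) at_top"
    proof -
      have "filterlim (\<lambda>y. - (2 * \<eta>) * (y - a)) at_bot at_top"
        using assms by real_asymp
      then have "((\<lambda>y. exp (- (2 * \<eta>) * (y - a))) \<longlongrightarrow> 0) at_top"
        by (rule filterlim_compose[OF exp_at_bot])
      from tendsto_divide[OF tendsto_minus[OF this] tendsto_const[of "2 * \<eta>"]] show ?thesis
        using assms by simp
    qed
  qed (use assms in \<open>auto intro!: derivative_eq_intros\<close>)
  then have "integrable lborel (\<lambda>y. indicator {a..} y * exp (- (2 * \<eta>) * (y - a)))"
    by (intro integrableI_bounded) (auto simp: abs_mult ennreal_mult'' ennreal_indicator mult.commute)
  then have "integrable lborel (\<lambda>y. (indicator {a<..} y * exp (- \<eta> * (y - a)))\<^sup>2)"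
  proof (rule Bochner_Integration.integrable_bound)
    show "AE y in lborel. norm ((indicator {a<..} y * exp (- \<eta> * (y - a)))\<^sup>2)
        \<le> norm (indicator {a..} y * exp (- (2 * \<eta>) * (y - a)))"
      by (auto simp: indicator_def power2_eq_square algebra_simps simp flip: exp_add)
  qed measurable
  then show ?thesis by (simp add: L2_space_def)
qed

section \<open>Damped Fourier representation of the Airy transform\<close>

definition airy_op :: "real \<Rightarrow> (real \<Rightarrow> real) \<Rightarrow> real \<Rightarrow> real" where
  "airy_op a f x = (LBINT y. Airy (x + y - a) * f y)"

text \<open>The weight is the y-part of the factor exp(-\<eta>(x + y - a)) coming from the shifted
  Airy integral.\<close>

definition damped_fourier :: "real \<Rightarrow> real \<Rightarrow> (real \<Rightarrow> real) \<Rightarrow> real \<Rightarrow> complex" where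
  "damped_fourier a \<eta> f t = (LBINT y. complex_of_real (f y * exp (- \<eta> * (y - a))) * iexp (t * y))"

definition airy_density :: "real \<Rightarrow> real \<Rightarrow> (real \<Rightarrow> real) \<Rightarrow> real \<Rightarrow> complex" where
  "airy_density a \<eta> f t = airy_symbol \<eta> t * iexp (- a * t) * damped_fourier a \<eta> f t"

text \<open>Right of a the weight is at most 1, which preserves L2 bounds, and it is itself in L2
  there, which by Cauchy-Schwarz makes the damped function integrable.\<close>

lemma
  assumes f: "f \<in> L2_space lborel" and supp: "\<forall>y \<le> a. f y = 0" and e: "\<eta> > 0"
  shows damped_L2: "(\<lambda>y. f y * exp (- \<eta> * (y - a))) \<in> L2_space lborel"
    and damped_L2_norm: "L2_norm_on lborel (\<lambda>y. f y * exp (- \<eta> * (y - a))) \<le> L2_norm_on lborel f"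
    and damped_integrable: "integrable lborel (\<lambda>y. f y * exp (- \<eta> * (y - a)))"
    and damped_L1_norm: "(LBINT y. \<bar>f y * exp (- \<eta> * (y - a))\<bar>) \<le>
      L2_norm_on lborel (\<lambda>y. indicator {a<..} y * exp (- \<eta> * (y - a))) * L2_norm_on lborel f"
proof -
  define w where "w y = indicator {a<..} y * exp (- \<eta> * (y - a))" for y
  have w: "w \<in> L2_space lborel" unfolding w_def by (rule halfline_exp_L2[OF e])
  have eq: "f y * exp (- \<eta> * (y - a)) = w y * f y" for y
    using supp by (auto simp: w_def indicator_def)
  have [measurable]: "f \<in> borel_measurable borel" using L2_measurable[OF f] by simp
  have le: "AE y in lborel. \<bar>f y * exp (- \<eta> * (y - a))\<bar> \<le> \<bar>f y\<bar>"
  proof (rule AE_I2)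
    fix y
    show "\<bar>f y * exp (- \<eta> * (y - a))\<bar> \<le> \<bar>f y\<bar>"
    proof (cases "y \<le> a")
      case True then show ?thesis by (simp add: supp)
    next
      case False
      then have "exp (- \<eta> * (y - a)) \<le> 1" using e by simp
      then show ?thesis by (simp only: abs_mult abs_exp_cancel) (simp add: mult_left_le)
    qed
  qed
  show "(\<lambda>y. f y * exp (- \<eta> * (y - a))) \<in> L2_space lborel"
    by (rule L2_bound[OF _ f le]) measurable
  show "L2_norm_on lborel (\<lambda>y. f y * exp (- \<eta> * (y - a))) \<le> L2_norm_on lborel f"
    by (rule L2_norm_on_mono[OF _ f le]) measurable
  show "integrable lborel (\<lambda>y. f y * exp (- \<eta> * (y - a)))"
    unfolding eq by (rule L2_mult_integrable[OF w f])
  have fa: "(\<lambda>y. \<bar>f y\<bar>) \<in> L2_space lborel" using f by (auto simp: L2_space_def)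
  have "(LBINT y. \<bar>f y * exp (- \<eta> * (y - a))\<bar>) = (LBINT y. w y * \<bar>f y\<bar>)"
    unfolding eq by (intro Bochner_Integration.integral_cong refl) (simp add: w_def abs_mult)
  also have "\<dots> \<le> L2_norm_on lborel w * L2_norm_on lborel (\<lambda>y. \<bar>f y\<bar>)"
    using L2_Cauchy_Schwarz[OF w fa] by simp
  finally show "(LBINT y. \<bar>f y * exp (- \<eta> * (y - a))\<bar>) \<le>
      L2_norm_on lborel (\<lambda>y. indicator {a<..} y * exp (- \<eta> * (y - a))) * L2_norm_on lborel f"
    by (simp add: w_def[abs_def] L2_norm_on_def)
qed

lemma damped_fourier_measurable [measurable]:
  assumes "f \<in> borel_measurable borel"
  shows "damped_fourier a \<eta> f \<in> borel_measurable borel"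
  unfolding damped_fourier_def using assms by measurable

lemma airy_density_measurable [measurable]:
  assumes "f \<in> borel_measurable borel"
  shows "airy_density a \<eta> f \<in> borel_measurable borel"
  unfolding airy_density_def using assms by measurable

lemma norm_airy_density:
  "cmod (airy_density a \<eta> f t) = exp (\<eta> ^ 3 / 3 - \<eta> * t\<^sup>2) * cmod (damped_fourier a \<eta> f t)"
  unfolding airy_density_def norm_mult norm_airy_symbol norm_exp_i_times by simp

text \<open>The bound is Gaussian in t and linear in the norm of f: the first property gives
  integrability and an entire extension, the second uniformity over a ball of L2.\<close>

lemma airy_density_bound:
  assumes f: "f \<in> L2_space lborel" and supp: "\<forall>y \<le> a. f y = 0" and e: "\<eta> > 0"
  shows "cmod (airy_density a \<eta> f t) \<le>
    exp (\<eta> ^ 3 / 3) * L2_norm_on lborel (\<lambda>y. indicator {a<..} y * exp (- \<eta> * (y - a)))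
      * L2_norm_on lborel f * exp (- \<eta> * t\<^sup>2)"
proof -
  have "cmod (damped_fourier a \<eta> f t) \<le> (LBINT y. \<bar>f y * exp (- \<eta> * (y - a))\<bar>)"
    unfolding damped_fourier_def
    by (rule order_trans[OF integral_norm_bound]) (simp add: norm_mult abs_mult)
  also note damped_L1_norm[OF assms]
  finally have "exp (\<eta> ^ 3 / 3 - \<eta> * t\<^sup>2) * cmod (damped_fourier a \<eta> f t) \<le>
     exp (\<eta> ^ 3 / 3 - \<eta> * t\<^sup>2) * (L2_norm_on lborel (\<lambda>y. indicator {a<..} y * exp (- \<eta> * (y - a)))
      * L2_norm_on lborel f)"
    by (rule mult_left_mono) (rule exp_ge_zero)
  moreover have "exp (\<eta> ^ 3 / 3 - \<eta> * t\<^sup>2) = exp (\<eta> ^ 3 / 3) * exp (- \<eta> * t\<^sup>2)"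
    by (simp flip: exp_add)
  ultimately show ?thesis by (simp add: norm_airy_density mult_ac)
qed

lemma airy_op_fourier:
  assumes f: "f \<in> L2_space lborel" and supp: "\<forall>y \<le> a. f y = 0" and e: "\<eta> > 0"
  shows "complex_of_real (airy_op a f x) =
    complex_of_real (exp (- \<eta> * x) / (2 * pi)) * (LBINT t. airy_density a \<eta> f t * iexp (x * t))"
proof -
  define g where "g y = complex_of_real (f y * exp (- \<eta> * (y - a)))" for y
  define c where "c = complex_of_real (exp (- \<eta> * x) / (2 * pi))"
  have [measurable]: "f \<in> borel_measurable borel" using L2_measurable[OF f] by simp
  have [measurable]: "g \<in> borel_measurable borel" unfolding g_def by measurable
  have g: "integrable lborel g" unfolding g_def by (rule integrable_of_real[OF damped_integrable[OF assms]])
  have int: "integrable (lborel \<Otimes>\<^sub>M lborel) (\<lambda>(t, y). airy_symbol \<eta> t * g y * iexp ((x + y - a) * t))"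
  proof (rule Bochner_Integration.integrable_bound)
    show "integrable (lborel \<Otimes>\<^sub>M lborel) (\<lambda>(t, y). airy_symbol \<eta> t * g y)"
      by (rule integrable_pair_mult[OF _ _ airy_symbol_integrable[OF e] g]) unfold_locales
  qed (auto simp: norm_mult)
  have "complex_of_real (airy_op a f x) = (LBINT y. complex_of_real (Airy (x + y - a)) * complex_of_real (f y))"
    unfolding airy_op_def by (simp flip: integral_complex_of_real)
  also have "\<dots> = (LBINT y. c * (LBINT t. airy_symbol \<eta> t * g y * iexp ((x + y - a) * t)))"
  proof (rule Bochner_Integration.integral_cong[OF refl])
    fix y
    have "complex_of_real (exp (- \<eta> * (x + y - a)) / (2 * pi)) * complex_of_real (f y) = c * g y"
    proof -
      have "exp (- \<eta> * (x + y - a)) = exp (- \<eta> * x) * exp (- \<eta> * (y - a))"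
        by (simp add: algebra_simps flip: exp_add)
      then show ?thesis by (simp add: c_def g_def)
    qed
    then have "(complex_of_real (exp (- \<eta> * (x + y - a)) / (2 * pi)) * complex_of_real (f y)) *
        (LBINT t. airy_symbol \<eta> t * iexp ((x + y - a) * t)) =
        (c * g y) * (LBINT t. airy_symbol \<eta> t * iexp ((x + y - a) * t))" by (rule arg_cong)
    then have "complex_of_real (Airy (x + y - a)) * complex_of_real (f y) =
        c * (g y * (LBINT t. airy_symbol \<eta> t * iexp ((x + y - a) * t)))"
      unfolding Airy_fourier[OF e] by (simp only: mult_ac)
    also have "g y * (LBINT t. airy_symbol \<eta> t * iexp ((x + y - a) * t)) =
        (LBINT t. g y * (airy_symbol \<eta> t * iexp ((x + y - a) * t)))" by (rule integral_mult_right_zero[symmetric])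
    also have "\<dots> = (LBINT t. airy_symbol \<eta> t * g y * iexp ((x + y - a) * t))"
      by (simp only: mult_ac)
    finally show "complex_of_real (Airy (x + y - a)) * complex_of_real (f y) =
        c * (LBINT t. airy_symbol \<eta> t * g y * iexp ((x + y - a) * t))" .
  qed
  also have "\<dots> = c * (LBINT y. (LBINT t. airy_symbol \<eta> t * g y * iexp ((x + y - a) * t)))"
    by (rule integral_mult_right_zero)
  also have "(LBINT y. (LBINT t. airy_symbol \<eta> t * g y * iexp ((x + y - a) * t))) =
      (LBINT t. (LBINT y. airy_symbol \<eta> t * g y * iexp ((x + y - a) * t)))"
    by (rule lborel_pair.Fubini_integral[OF int])
  also have "\<dots> = (LBINT t. airy_density a \<eta> f t * iexp (x * t))"
  proof (rule Bochner_Integration.integral_cong[OF refl])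
    fix t
    have split: "iexp ((x + y - a) * t) = iexp (x * t) * iexp (- a * t) * iexp (t * y)" for y
      by (simp add: algebra_simps flip: exp_add)
    have "(LBINT y. airy_symbol \<eta> t * g y * iexp ((x + y - a) * t)) =
        (LBINT y. (airy_symbol \<eta> t * iexp (- a * t) * iexp (x * t)) * (g y * iexp (t * y)))"
      unfolding split by (simp only: mult_ac)
    also have "\<dots> = (airy_symbol \<eta> t * iexp (- a * t) * iexp (x * t)) * damped_fourier a \<eta> f t"
      unfolding damped_fourier_def g_def by (rule integral_mult_right_zero)
    finally show "(LBINT y. airy_symbol \<eta> t * g y * iexp ((x + y - a) * t)) = airy_density a \<eta> f t * iexp (x * t)"
      by (simp add: airy_density_def mult_ac)
  qed
  finally show ?thesis by (simp add: c_def)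
qed

text \<open>Two applications of Bessel's inequality contribute 2 pi each, which cancels the squared
  prefactor 1/(2 pi)^2. Between them the multiplier has modulus at most exp(\<eta>^3/3). The weight
  exp(\<eta> x) undoes the factor exp(-\<eta> x) of the representation.\<close>

lemma airy_op_weighted_contraction:
  assumes f: "f \<in> L2_space lborel" and supp: "\<forall>y \<le> a. f y = 0" and e: "\<eta> > 0"
  shows "(\<integral>\<^sup>+x. ennreal ((exp (\<eta> * x) * airy_op a f x)\<^sup>2) \<partial>lborel) \<le>
    ennreal (exp (2 * \<eta> ^ 3 / 3) * (L2_norm_on lborel f)\<^sup>2)"
proof -
  define g where "g y = f y * exp (- \<eta> * (y - a))" for y
  define G where "G = airy_density a \<eta> f"
  define D where "D = damped_fourier a \<eta> f"
  have [measurable]: "f \<in> borel_measurable borel" using L2_measurable[OF f] by simp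
  have [measurable]: "G \<in> borel_measurable borel" unfolding G_def by measurable
  have [measurable]: "D \<in> borel_measurable borel" unfolding D_def by measurable
  obtain K where K: "\<And>t. cmod (G t) \<le> K * exp (- \<eta> * t\<^sup>2)"
    using airy_density_bound[OF assms] unfolding G_def by blast
  have G1: "integrable lborel G"
  proof (rule Bochner_Integration.integrable_bound)
    show "integrable lborel (\<lambda>t. K * exp (0 * t - \<eta> * t\<^sup>2))"
      by (intro integrable_mult_right gaussian_exp_integrable e)
    show "AE t in lborel. norm (G t) \<le> norm (K * exp (0 * t - \<eta> * t\<^sup>2))"
      using K by (auto intro: order_trans[OF _ abs_ge_self])
  qed simp
  have G2: "integrable lborel (\<lambda>t. (cmod (G t))\<^sup>2)"
  proof (rule Bochner_Integration.integrable_bound)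
    show "integrable lborel (\<lambda>t. K\<^sup>2 * exp (0 * t - (2 * \<eta>) * t\<^sup>2))"
      by (intro integrable_mult_right gaussian_exp_integrable) (use e in simp)
    show "AE t in lborel. norm ((cmod (G t))\<^sup>2) \<le> norm (K\<^sup>2 * exp (0 * t - (2 * \<eta>) * t\<^sup>2))"
    proof (rule AE_I2)
      fix t
      have "(cmod (G t))\<^sup>2 \<le> (K * exp (- \<eta> * t\<^sup>2))\<^sup>2" by (rule power_mono[OF K]) simp
      also have "\<dots> = K\<^sup>2 * exp (0 * t - (2 * \<eta>) * t\<^sup>2)"
        by (simp add: power_mult_distrib flip: exp_double)
      finally show "norm ((cmod (G t))\<^sup>2) \<le> norm (K\<^sup>2 * exp (0 * t - (2 * \<eta>) * t\<^sup>2))" by simp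
    qed
  qed simp
  have g1: "integrable lborel (\<lambda>y. complex_of_real (g y))"
    unfolding g_def by (rule integrable_of_real[OF damped_integrable[OF assms]])
  have g2: "integrable lborel (\<lambda>y. (cmod (complex_of_real (g y)))\<^sup>2)"
    unfolding norm_of_real power2_abs g_def by (rule L2_integrable[OF damped_L2[OF assms]])
  have "(LBINT y. (cmod (complex_of_real (g y)))\<^sup>2) \<le> (L2_norm_on lborel f)\<^sup>2"
    unfolding norm_of_real power2_abs g_def L2_norm_on_square[symmetric]
    by (rule power_mono[OF damped_L2_norm[OF assms]]) simp
  then have D2: "(\<integral>\<^sup>+t. ennreal ((cmod (D t))\<^sup>2) \<partial>lborel) \<le> ennreal (2 * pi * (L2_norm_on lborel f)\<^sup>2)"
    using bessel_inequality[OF g1 g2]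
    by (auto simp: D_def damped_fourier_def g_def intro: order_trans[OF _ ennreal_leI])
  have GD: "(cmod (G t))\<^sup>2 \<le> exp (2 * \<eta> ^ 3 / 3) * (cmod (D t))\<^sup>2" for t
  proof -
    have "exp (\<eta> ^ 3 / 3 - \<eta> * t\<^sup>2) \<le> exp (\<eta> ^ 3 / 3)" using e by simp
    then have "cmod (G t) \<le> exp (\<eta> ^ 3 / 3) * cmod (D t)"
      unfolding G_def norm_airy_density D_def by (rule mult_right_mono) simp
    then have "(cmod (G t))\<^sup>2 \<le> (exp (\<eta> ^ 3 / 3) * cmod (D t))\<^sup>2" by (rule power_mono) simp
    also have "\<dots> = exp (2 * \<eta> ^ 3 / 3) * (cmod (D t))\<^sup>2"
      by (simp add: power_mult_distrib flip: exp_double)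
    finally show ?thesis .
  qed
  have "ennreal (LBINT t. (cmod (G t))\<^sup>2) = (\<integral>\<^sup>+t. ennreal ((cmod (G t))\<^sup>2) \<partial>lborel)"
    by (rule nn_integral_eq_integral[symmetric, OF G2]) simp
  also have "\<dots> \<le> (\<integral>\<^sup>+t. ennreal (exp (2 * \<eta> ^ 3 / 3)) * ennreal ((cmod (D t))\<^sup>2) \<partial>lborel)"
    by (intro nn_integral_mono) (use GD in \<open>simp flip: ennreal_mult add: ennreal_leI\<close>)
  also have "\<dots> = ennreal (exp (2 * \<eta> ^ 3 / 3)) * (\<integral>\<^sup>+t. ennreal ((cmod (D t))\<^sup>2) \<partial>lborel)"
    by (rule nn_integral_cmult) simp
  also have "\<dots> \<le> ennreal (exp (2 * \<eta> ^ 3 / 3)) * ennreal (2 * pi * (L2_norm_on lborel f)\<^sup>2)"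
    by (rule mult_left_mono[OF D2]) simp
  finally have "ennreal (LBINT t. (cmod (G t))\<^sup>2) \<le> ennreal (exp (2 * \<eta> ^ 3 / 3) * (2 * pi * (L2_norm_on lborel f)\<^sup>2))"
    by (simp add: ennreal_mult)
  then have G2_le: "(LBINT t. (cmod (G t))\<^sup>2) \<le> exp (2 * \<eta> ^ 3 / 3) * (2 * pi * (L2_norm_on lborel f)\<^sup>2)"
    by (subst (asm) ennreal_le_iff) auto
  have sq: "(exp (\<eta> * x) * airy_op a f x)\<^sup>2 = (1 / (4 * pi\<^sup>2)) * (cmod (LBINT t. G t * iexp (x * t)))\<^sup>2" for x
  proof -
    have "exp (\<eta> * x) * exp (- \<eta> * x) = 1" by (simp flip: exp_add)
    then have "complex_of_real (exp (\<eta> * x) * airy_op a f x) = complex_of_real (1 / (2 * pi)) * (LBINT t. G t * iexp (x * t))"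
      unfolding of_real_mult[of "exp (\<eta> * x)"] airy_op_fourier[OF assms, of x] mult.assoc[symmetric] G_def
      by (simp flip: of_real_mult mult.assoc)
    then have "cmod (complex_of_real (exp (\<eta> * x) * airy_op a f x)) =
        cmod (complex_of_real (1 / (2 * pi)) * (LBINT t. G t * iexp (x * t)))" by (rule arg_cong)
    then have "\<bar>exp (\<eta> * x) * airy_op a f x\<bar> = \<bar>1 / (2 * pi)\<bar> * cmod (LBINT t. G t * iexp (x * t))"
      unfolding norm_of_real norm_mult[of "complex_of_real (1 / (2 * pi))"] .
    then have "\<bar>exp (\<eta> * x) * airy_op a f x\<bar> = 1 / (2 * pi) * cmod (LBINT t. G t * iexp (x * t))"
      by simp
    then have "\<bar>exp (\<eta> * x) * airy_op a f x\<bar>\<^sup>2 = (1 / (2 * pi) * cmod (LBINT t. G t * iexp (x * t)))\<^sup>2" by simp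
    then show ?thesis by (simp add: power_mult_distrib power_divide)
  qed
  have "(\<integral>\<^sup>+x. ennreal ((exp (\<eta> * x) * airy_op a f x)\<^sup>2) \<partial>lborel) =
      (\<integral>\<^sup>+x. ennreal (1 / (4 * pi\<^sup>2)) * ennreal ((cmod (LBINT t. G t * iexp (x * t)))\<^sup>2) \<partial>lborel)"
    unfolding sq by (intro nn_integral_cong ennreal_mult) auto
  also have "\<dots> = ennreal (1 / (4 * pi\<^sup>2)) * (\<integral>\<^sup>+x. ennreal ((cmod (LBINT t. G t * iexp (x * t)))\<^sup>2) \<partial>lborel)"
    by (rule nn_integral_cmult) measurable
  also have "\<dots> \<le> ennreal (1 / (4 * pi\<^sup>2)) * ennreal (2 * pi * (LBINT t. (cmod (G t))\<^sup>2))"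
    by (intro mult_left_mono bessel_inequality G1 G2) simp
  also have "\<dots> \<le> ennreal (1 / (4 * pi\<^sup>2)) * ennreal (2 * pi * (exp (2 * \<eta> ^ 3 / 3) * (2 * pi * (L2_norm_on lborel f)\<^sup>2)))"
    by (intro mult_left_mono ennreal_leI G2_le) auto
  also have "\<dots> = ennreal (exp (2 * \<eta> ^ 3 / 3) * (L2_norm_on lborel f)\<^sup>2)"
    by (subst ennreal_mult[symmetric]) (auto simp: field_simps power2_eq_square)
  finally show ?thesis .
qed

lemma airy_op_measurable [measurable]:
  assumes [measurable]: "f \<in> borel_measurable borel"
  shows "airy_op a f \<in> borel_measurable borel"
  unfolding airy_op_def by measurable

text \<open>Fatou's lemma along heights tending to 0: the weight in x and the constant exp(2
  \<eta>^3/3) both tend to 1.\<close>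

lemma airy_op_contraction:
  assumes f: "f \<in> L2_space lborel" and supp: "\<forall>y \<le> a. f y = 0"
  shows "(\<integral>\<^sup>+x. ennreal ((airy_op a f x)\<^sup>2) \<partial>lborel) \<le> ennreal ((L2_norm_on lborel f)\<^sup>2)"
proof -
  define h where "h n = inverse (real (Suc n))" for n
  have h: "h \<longlonglongrightarrow> 0" unfolding h_def by (rule LIMSEQ_inverse_real_of_nat)
  have [measurable]: "f \<in> borel_measurable borel" using L2_measurable[OF f] by simp
  have lim: "(\<lambda>n. ennreal ((exp (h n * x) * airy_op a f x)\<^sup>2)) \<longlonglongrightarrow> ennreal ((airy_op a f x)\<^sup>2)" for x
  proof -
    have "(\<lambda>n. (exp (h n * x) * airy_op a f x)\<^sup>2) \<longlonglongrightarrow> (exp (0 * x) * airy_op a f x)\<^sup>2"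
      by (intro tendsto_intros h)
    then show ?thesis by (intro tendsto_ennrealI) simp
  qed
  have "(\<integral>\<^sup>+x. ennreal ((airy_op a f x)\<^sup>2) \<partial>lborel) =
      (\<integral>\<^sup>+x. liminf (\<lambda>n. ennreal ((exp (h n * x) * airy_op a f x)\<^sup>2)) \<partial>lborel)"
    by (rule nn_integral_cong) (metis lim_imp_Liminf lim trivial_limit_sequentially)
  also have "\<dots> \<le> liminf (\<lambda>n. \<integral>\<^sup>+x. ennreal ((exp (h n * x) * airy_op a f x)\<^sup>2) \<partial>lborel)"
    by (rule nn_integral_liminf) measurable
  also have "\<dots> \<le> liminf (\<lambda>n. ennreal (exp (2 * h n ^ 3 / 3) * (L2_norm_on lborel f)\<^sup>2))"
    by (intro Liminf_mono always_eventually allI airy_op_weighted_contraction f supp) (auto simp: h_def)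
  also have "\<dots> = ennreal ((L2_norm_on lborel f)\<^sup>2)"
  proof (rule lim_imp_Liminf[OF trivial_limit_sequentially])
    have "(\<lambda>n. exp (2 * h n ^ 3 / 3) * (L2_norm_on lborel f)\<^sup>2) \<longlonglongrightarrow> exp (2 * 0 ^ 3 / 3) * (L2_norm_on lborel f)\<^sup>2"
      by (intro tendsto_intros h) simp
    then show "(\<lambda>n. ennreal (exp (2 * h n ^ 3 / 3) * (L2_norm_on lborel f)\<^sup>2)) \<longlonglongrightarrow> ennreal ((L2_norm_on lborel f)\<^sup>2)"
      by (intro tendsto_ennrealI) simp
  qed
  finally show ?thesis .
qed

section \<open>Entire extension of the Airy transform\<close>

definition airy_op_entire :: "real \<Rightarrow> (real \<Rightarrow> real) \<Rightarrow> complex \<Rightarrow> complex" where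
  "airy_op_entire a f z = exp (- z) / (2 * of_real pi) * (LBINT t. airy_density a 1 f t * exp (\<i> * z * of_real t))"

lemma airy_op_entire_real:
  assumes "f \<in> L2_space lborel" "\<forall>y \<le> a. f y = 0"
  shows "airy_op_entire a f (of_real x) = of_real (airy_op a f x)"
  unfolding airy_op_entire_def
  using airy_op_fourier[OF assms zero_less_one, of x] exp_of_real[of "- x", where 'a = complex] by (simp add: mult.assoc)

lemma airy_op_entire_holomorphic:
  assumes f: "f \<in> L2_space lborel" and supp: "\<forall>y \<le> a. f y = 0"
  shows "airy_op_entire a f holomorphic_on UNIV"
proof -
  have [measurable]: "f \<in> borel_measurable borel" using L2_measurable[OF f] by simp
  show ?thesis
    unfolding airy_op_entire_def
    by (intro holomorphic_intros fourier_entire(1)[OF _ airy_density_bound[OF f supp zero_less_one] zero_less_one])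
      auto
qed

text \<open>The point is the order of quantifiers: B depends on a and r alone, so the transforms of
  a unit ball form a locally bounded family.\<close>

lemma airy_op_entire_locally_bounded:
  "\<exists>B \<ge> 0. \<forall>f z. f \<in> L2_space lborel \<longrightarrow> (\<forall>y \<le> a. f y = 0) \<longrightarrow> cmod z \<le> r \<longrightarrow>
    cmod (airy_op_entire a f z) \<le> B * L2_norm_on lborel f"
proof -
  define K where "K = exp (1 ^ 3 / 3) * L2_norm_on lborel (\<lambda>y. indicator {a<..} y * exp (- 1 * (y - a)))"
  define J where "J = (LBINT t. exp (r * \<bar>t\<bar> - 1 * t\<^sup>2))"
  define B where "B = exp r / (2 * pi) * (K * J)"
  have "K \<ge> 0" "J \<ge> 0" by (auto simp: K_def J_def)
  then have "B \<ge> 0" by (simp add: B_def)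
  moreover have "cmod (airy_op_entire a f z) \<le> B * L2_norm_on lborel f"
    if f: "f \<in> L2_space lborel" and supp: "\<forall>y \<le> a. f y = 0" and z: "cmod z \<le> r" for f z
  proof -
    have [measurable]: "f \<in> borel_measurable borel" using L2_measurable[OF f] by simp
    have "cmod (LBINT t. airy_density a 1 f t * exp (\<i> * z * of_real t)) \<le> K * L2_norm_on lborel f * J"
      unfolding J_def
    proof (rule fourier_entire(2)[OF _ _ zero_less_one z])
      show "cmod (airy_density a 1 f t) \<le> K * L2_norm_on lborel f * exp (- 1 * t\<^sup>2)" for t
        unfolding K_def by (rule airy_density_bound[OF f supp zero_less_one])
    qed measurable
    moreover have "cmod (exp (- z)) \<le> exp r"
      using norm_exp[of "- z"] z by (auto intro: order_trans)
    ultimately have "cmod (exp (- z)) * cmod (LBINT t. airy_density a 1 f t * exp (\<i> * z * of_real t))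
        \<le> exp r * (K * L2_norm_on lborel f * J)"
      by (intro mult_mono) auto
    then show ?thesis
      by (simp add: airy_op_entire_def B_def norm_mult norm_divide divide_right_mono mult_ac)
  qed
  ultimately show ?thesis by blast
qed

section \<open>The Airy operator on a half-line\<close>

locale contractive_hilbert_schmidt = hilbert_schmidt +
  assumes gap: "\<exists>q. 0 \<le> q \<and> q < 1 \<and> (\<forall>f \<in> L2_space M. L2_norm_on M (H f) \<le> q * L2_norm_on M f)"
begin

text \<open>A relation instead of an inverse operator: solutions are unique only up to null sets and
  \<open>Airy_resolvent\<close> selects an arbitrary one, so facts are proved for every
  solution.\<close>

definition solves :: "('a \<Rightarrow> real) \<Rightarrow> ('a \<Rightarrow> real) \<Rightarrow> bool" where
  "solves r f \<longleftrightarrow> r \<in> L2_space M \<and> (AE x in M. r x - H (H r) x = f x)"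

lemma solves_exists:
  assumes "f \<in> L2_space M"
  shows "\<exists>r. solves r f"
proof -
  obtain q where q: "0 \<le> q" "q < 1" "\<And>f. f \<in> L2_space M \<Longrightarrow> L2_norm_on M (H f) \<le> q * L2_norm_on M f"
    using gap by blast
  obtain r where "r \<in> L2_space M" "\<forall>x \<in> space M. r x - H (H r) x = f x"
    using neumann_exists[OF q assms] by blast
  then have "solves r f" unfolding solves_def by (intro conjI AE_I2) auto
  then show ?thesis by blast
qed

lemma solves_combine:
  assumes "solves r f" "solves s g"
  shows "solves (\<lambda>x. r x + c * s x) (\<lambda>x. f x + c * g x)"
proof -
  have r: "r \<in> L2_space M" and s: "s \<in> L2_space M" using assms by (auto simp: solves_def)
  have cs: "(\<lambda>x. c * s x) \<in> L2_space M" by (rule L2_scale[OF s])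
  have 1: "H (\<lambda>x. r x + c * s x) x = H r x + c * H s x" if "x \<in> space M" for x
    using H_add[OF r cs that] by (simp add: H_scale)
  have 2: "H (H (\<lambda>x. r x + c * s x)) x = H (H r) x + c * H (H s) x" if x: "x \<in> space M" for x
  proof -
    have "H (H (\<lambda>x. r x + c * s x)) x = H (\<lambda>x. H r x + c * H s x) x"
      unfolding H_def[of "H (\<lambda>x. r x + c * s x)"] H_def[of "\<lambda>x. H r x + c * H s x"]
      by (intro Bochner_Integration.integral_cong refl) (simp add: 1)
    then show ?thesis using H_add[OF H_L2[OF r] L2_scale[OF H_L2[OF s]] x] by (simp add: H_scale)
  qed
  have "AE x in M. (r x + c * s x) - H (H (\<lambda>x. r x + c * s x)) x = f x + c * g x"
  proof -
    have "AE x in M. r x - H (H r) x = f x" "AE x in M. s x - H (H s) x = g x"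
      using assms by (auto simp: solves_def)
    then show ?thesis using AE_space
    proof eventually_elim
      case (elim x)
      show ?case unfolding 2[OF elim(3)] elim(1,2)[symmetric] by (simp add: algebra_simps)
    qed
  qed
  then show ?thesis using L2_add[OF r cs] by (simp add: solves_def)
qed

lemma solves_unique:
  assumes "solves r f" "solves s f"
  shows "AE x in M. r x = s x"
proof -
  have d: "solves (\<lambda>x. r x + (-1) * s x) (\<lambda>x. f x + (-1) * f x)" by (rule solves_combine[OF assms])
  obtain q where q: "q < 1" "\<And>f. f \<in> L2_space M \<Longrightarrow> L2_norm_on M (H f) \<le> q * L2_norm_on M f"
    using gap by blast
  have "AE x in M. r x + (-1) * s x = 0"
    by (rule neumann_unique[OF q]) (use d in \<open>simp_all add: solves_def\<close>)
  then show ?thesis by simp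
qed

text \<open>\<open>H\<close> commutes with the inverse of 1 - H^2. The equation for r holds almost
  everywhere, but after one application of \<open>H\<close> it holds everywhere by
  \<open>H_cong\<close>.\<close>

lemma solves_H:
  assumes "solves r f" and f: "f \<in> L2_space M"
  shows "solves (H r) (H f)"
proof -
  have r: "r \<in> L2_space M" and eq: "AE x in M. r x - H (H r) x = f x"
    using assms by (auto simp: solves_def)
  note HHr = H_L2[OF H_L2[OF r]]
  have "H r x - H (H (H r)) x = H f x" if x: "x \<in> space M" for x
    using H_cong[OF L2_measurable[OF L2_diff[OF r HHr]] L2_measurable[OF f] eq x] H_diff[OF r HHr x] by simp
  then show ?thesis using H_L2[OF r] by (simp add: solves_def)
qed

lemma solves_scale:
  assumes "solves r f"
  shows "solves (\<lambda>x. c * r x) (\<lambda>x. c * f x)"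
proof -
  have "solves (\<lambda>_. 0) (\<lambda>_. 0)" by (simp add: solves_def L2_space_def H_def)
  from solves_combine[OF this assms, of c] show ?thesis by simp
qed

text \<open>Lets the representative picked by choice be exchanged for an explicit solution under an
  integral.\<close>

lemma integral_solves_cong:
  assumes "solves r f" "solves s f" and [measurable]: "u \<in> borel_measurable M"
  shows "(\<integral>x. u x * r x \<partial>M) = (\<integral>x. u x * s x \<partial>M)"
proof (rule integral_cong_AE)
  have [measurable]: "r \<in> borel_measurable M" "s \<in> borel_measurable M"
    using assms(1,2) by (auto simp: solves_def L2_measurable)
  show "(\<lambda>x. u x * r x) \<in> borel_measurable M" "(\<lambda>x. u x * s x) \<in> borel_measurable M" by measurable
  show "AE x in M. u x * r x = u x * s x"
    using solves_unique[OF assms(1,2)] by auto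
qed

text \<open>The weak form of H (1 - H^2)^-1 H = (1 - H^2)^-1 - 1: one \<open>H\<close> is moved
  across the pairing and H^2 r is replaced by r - f.\<close>

lemma integral_H_solution:
  assumes f: "f \<in> L2_space M" and g: "g \<in> L2_space M" and r: "solves r f"
  shows "(\<integral>x. H g x * H r x \<partial>M) = (\<integral>x. g x * r x \<partial>M) - (\<integral>x. f x * g x \<partial>M)"
proof -
  have rL: "r \<in> L2_space M" using r by (auto simp: solves_def)
  note [measurable] = L2_measurable[OF rL] L2_measurable[OF f] L2_measurable[OF g]
  have "(\<integral>x. H g x * H r x \<partial>M) = (\<integral>x. g x * H (H r) x \<partial>M)"
    by (rule H_self_adjoint[OF g H_L2[OF rL], symmetric])
  also have "\<dots> = (\<integral>x. g x * r x - f x * g x \<partial>M)"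
  proof (rule integral_cong_AE)
    have "AE x in M. r x - H (H r) x = f x" using r by (simp add: solves_def)
    then show "AE x in M. g x * H (H r) x = g x * r x - f x * g x"
      by eventually_elim (auto simp: algebra_simps)
  qed measurable
  also have "\<dots> = (\<integral>x. g x * r x \<partial>M) - (\<integral>x. f x * g x \<partial>M)"
    using L2_mult_integrable[OF g rL] L2_mult_integrable[OF f g] by simp
  finally show ?thesis .
qed

end

section \<open>The half-line and extension by zero\<close>

abbreviation halfline :: "real \<Rightarrow> real measure" where
  "halfline a \<equiv> restrict_space lborel {a<..}"

abbreviation extend_zero :: "real \<Rightarrow> (real \<Rightarrow> real) \<Rightarrow> real \<Rightarrow> real" where
  "extend_zero a f \<equiv> (\<lambda>y. indicator {a<..} y * f y)"

lemma integral_halfline: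
  fixes f :: "real \<Rightarrow> real"
  shows "(\<integral>x. f x \<partial>halfline a) = (LBINT x:{a<..}. f x)"
  by (subst integral_restrict_space) (auto simp: set_lebesgue_integral_def)

lemma L2_halfline_eq: "L2_halfline a = L2_space (halfline a)"
  unfolding L2_halfline_def L2_space_def set_borel_measurable_def set_integrable_def
  by (auto simp: borel_measurable_restrict_space_iff integrable_restrict_space)

lemma extend_zero_L2:
  assumes "f \<in> L2_space (halfline a)" shows "extend_zero a f \<in> L2_space lborel"
proof -
  have "(\<lambda>y. (extend_zero a f y)\<^sup>2) = (\<lambda>y. indicator {a<..} y * (f y)\<^sup>2)"
    by (auto simp: indicator_def)
  then show ?thesis
    using assms by (auto simp: L2_space_def borel_measurable_restrict_space_iff integrable_restrict_space)
qed

lemma extend_zero_norm: "L2_norm_on lborel (extend_zero a f) = L2_norm_on (halfline a) f"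
proof -
  have "(\<lambda>y. (extend_zero a f y)\<^sup>2) = (\<lambda>y. indicator {a<..} y *\<^sub>R (f y)\<^sup>2)"
    by (auto simp: indicator_def)
  then show ?thesis
    by (simp add: L2_norm_on_def integral_halfline set_lebesgue_integral_def)
qed

lemma L2_halflineI:
  assumes "f \<in> borel_measurable borel" and e: "\<eta> > 0"
    and "\<And>x. x > a \<Longrightarrow> \<bar>f x\<bar> \<le> C * exp (- \<eta> * (x - a))"
  shows "f \<in> L2_space (halfline a)"
proof -
  have "(\<lambda>x. C * (indicator {a<..} x * exp (- \<eta> * (x - a)))) \<in> L2_space lborel"
    by (rule L2_scale[OF halfline_exp_L2[OF e]])
  then have "extend_zero a f \<in> L2_space lborel"
    by (rule L2_bound[rotated]) (use assms in \<open>auto simp: indicator_def intro: order_trans[OF _ abs_ge_self]\<close>)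
  moreover have "(\<lambda>y. (extend_zero a f y)\<^sup>2) = (\<lambda>y. indicator {a<..} y * (f y)\<^sup>2)"
    by (auto simp: indicator_def)
  ultimately show ?thesis
    by (auto simp: L2_space_def borel_measurable_restrict_space_iff integrable_restrict_space)
qed

text \<open>The decay estimate at height 1 bounds the kernel by a product of decaying exponentials
  in x and in y, which settles both the row condition and the Hilbert-Schmidt condition.\<close>

interpretation airy: hilbert_schmidt "halfline a" "\<lambda>x y. Airy (x + y - a)" for a
proof -
  define A where "A = (LBINT t. cmod (airy_symbol 1 t)) / (2 * pi)"
  have A: "\<bar>Airy (x + y - a)\<bar> \<le> (A * exp (- x)) * exp (- 1 * (y - a))" for x y
  proof -
    have "\<bar>Airy (x + y - a)\<bar> \<le> A * exp (- 1 * (x + y - a))"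
      unfolding A_def by (rule Airy_bound) simp
    also have "exp (- 1 * (x + y - a)) = exp (- x) * exp (- 1 * (y - a))"
      by (simp flip: exp_add)
    finally show ?thesis by (simp add: mult.assoc)
  qed
  have "A \<ge> 0" by (simp add: A_def)
  define w where "w y = exp (- 1 * (y - a))" for y
  have w: "w \<in> L2_space (halfline a)"
    unfolding w_def by (rule L2_halflineI[of _ 1 a 1]) auto
  have id [measurable]: "(\<lambda>x. x) \<in> halfline a \<rightarrow>\<^sub>M borel"
    by (rule measurable_restrict_space1) simp
  have meas: "(\<lambda>(x, y). Airy (x + y - a)) \<in> borel_measurable (halfline a \<Otimes>\<^sub>M halfline a)"
  proof -
    have [measurable]: "fst \<in> halfline a \<Otimes>\<^sub>M halfline a \<rightarrow>\<^sub>M borel" "snd \<in> halfline a \<Otimes>\<^sub>M halfline a \<rightarrow>\<^sub>M borel"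
      using measurable_compose[OF measurable_fst id] measurable_compose[OF measurable_snd id] by (auto simp: comp_def)
    show ?thesis unfolding case_prod_beta' by measurable
  qed
  have sf: "sigma_finite_measure (halfline a)"
    by (rule sigma_finite_measure_restrict_space) (auto intro: lborel.sigma_finite_measure_axioms)
  then interpret sigma_finite_measure "halfline a" .
  have rowL2: "(\<lambda>y. Airy (x + y - a)) \<in> L2_space (halfline a)" for x
    by (rule L2_halflineI[OF _ zero_less_one A]) measurable
  have "integrable (halfline a) (\<lambda>x. \<integral>y. (Airy (x + y - a))\<^sup>2 \<partial>halfline a)"
  proof (rule Bochner_Integration.integrable_bound)
    define C where "C = A * exp (- a) * L2_norm_on (halfline a) w"
    show "integrable (halfline a) (\<lambda>x. C\<^sup>2 * (w x)\<^sup>2)"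
      using L2_integrable[OF w] by simp
    show "(\<lambda>x. \<integral>y. (Airy (x + y - a))\<^sup>2 \<partial>halfline a) \<in> borel_measurable (halfline a)"
    proof (rule borel_measurable_lebesgue_integral)
      show "(\<lambda>(x, y). (Airy (x + y - a))\<^sup>2) \<in> borel_measurable (halfline a \<Otimes>\<^sub>M halfline a)"
        using borel_measurable_power[OF meas, of 2] by (simp add: case_prod_beta')
    qed
    show "AE x in halfline a. norm (\<integral>y. (Airy (x + y - a))\<^sup>2 \<partial>halfline a) \<le> norm (C\<^sup>2 * (w x)\<^sup>2)"
    proof (rule AE_I2)
      fix x
      have "L2_norm_on (halfline a) (\<lambda>y. Airy (x + y - a)) \<le> L2_norm_on (halfline a) (\<lambda>y. (A * exp (- x)) * w y)"
        by (rule L2_norm_on_mono[OF L2_measurable[OF rowL2] L2_scale[OF w]])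
          (use A in \<open>auto simp: w_def intro: order_trans[OF _ abs_ge_self]\<close>)
      also have "\<dots> = A * exp (- x) * L2_norm_on (halfline a) w"
        unfolding L2_norm_on_scale using \<open>A \<ge> 0\<close> by (simp add: abs_mult)
      also have "exp (- x) = exp (- a) * w x"
        by (simp add: w_def flip: exp_add)
      finally have "L2_norm_on (halfline a) (\<lambda>y. Airy (x + y - a)) \<le> C * w x" by (simp add: C_def mult_ac)
      then have "(L2_norm_on (halfline a) (\<lambda>y. Airy (x + y - a)))\<^sup>2 \<le> (C * w x)\<^sup>2"
        by (rule power_mono) simp
      then show "norm (\<integral>y. (Airy (x + y - a))\<^sup>2 \<partial>halfline a) \<le> norm (C\<^sup>2 * (w x)\<^sup>2)"
        by (simp add: L2_norm_on_square power_mult_distrib)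
    qed
  qed
  then show "hilbert_schmidt (halfline a) (\<lambda>x y. Airy (x + y - a))"
    using meas rowL2 by unfold_locales (auto simp: L2_integrable add.commute)
qed

lemma airy_H_eq: "airy.H a f x = airy_op a (extend_zero a f) x"
  unfolding airy.H_def airy_op_def integral_halfline set_lebesgue_integral_def
  by (intro Bochner_Integration.integral_cong refl) (simp add: mult_ac)

lemma extend_zero_vanishes: "\<forall>y \<le> a. extend_zero a f y = 0"
  by auto

text \<open>The norm of \<open>H f\<close> records only the mass of the full transform to the right
  of a; injectivity exploits the part that is cut off.\<close>

lemma airy_H_square:
  assumes f: "f \<in> L2_space (halfline a)"
  shows "ennreal ((L2_norm_on (halfline a) (airy.H a f))\<^sup>2) =
    (\<integral>\<^sup>+x. ennreal ((airy_op a (extend_zero a f) x)\<^sup>2) * indicator {a<..} x \<partial>lborel)"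
proof -
  have "ennreal ((L2_norm_on (halfline a) (airy.H a f))\<^sup>2) = (\<integral>\<^sup>+x. ennreal ((airy.H a f x)\<^sup>2) \<partial>halfline a)"
    unfolding L2_norm_on_square
    by (rule nn_integral_eq_integral[symmetric, OF L2_integrable[OF airy.H_L2[OF f]]]) simp
  also have "\<dots> = (\<integral>\<^sup>+x. ennreal ((airy_op a (extend_zero a f) x)\<^sup>2) * indicator {a<..} x \<partial>lborel)"
    unfolding airy_H_eq by (rule nn_integral_restrict_space) simp
  finally show ?thesis .
qed

lemma airy_H_contraction:
  assumes f: "f \<in> L2_space (halfline a)"
  shows "L2_norm_on (halfline a) (airy.H a f) \<le> L2_norm_on (halfline a) f"
proof -
  note F = extend_zero_L2[OF f]
  have "ennreal ((L2_norm_on (halfline a) (airy.H a f))\<^sup>2) \<le> (\<integral>\<^sup>+x. ennreal ((airy_op a (extend_zero a f) x)\<^sup>2) \<partial>lborel)"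
    unfolding airy_H_square[OF f] by (intro nn_integral_mono) (simp add: indicator_def)
  also have "\<dots> \<le> ennreal ((L2_norm_on (halfline a) f)\<^sup>2)"
    using airy_op_contraction[OF F extend_zero_vanishes] by (simp add: extend_zero_norm)
  finally have "(L2_norm_on (halfline a) (airy.H a f))\<^sup>2 \<le> (L2_norm_on (halfline a) f)\<^sup>2"
    by (simp add: ennreal_le_iff)
  then show ?thesis by (rule power2_le_imp_le) simp
qed

lemma airy_op_vanishes:
  assumes f: "f \<in> L2_space lborel" and supp: "\<forall>y \<le> a. f y = 0"
    and zero: "AE x in lborel. x < a \<longrightarrow> airy_op a f x = 0"
  shows "airy_op a f x = 0"
proof -
  have hol: "airy_op_entire a f holomorphic_on UNIV" by (rule airy_op_entire_holomorphic[OF f supp])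
  have real: "airy_op a f x = Re (airy_op_entire a f (of_real x))" for x
    using airy_op_entire_real[OF f supp, of x] by simp
  have "continuous_on UNIV (\<lambda>x. airy_op_entire a f (of_real x))"
    by (rule continuous_on_compose2[OF holomorphic_on_imp_continuous_on[OF hol]]) (auto intro!: continuous_intros)
  then have cont: "continuous_on UNIV (airy_op a f)"
    unfolding real by (intro continuous_intros)
  define S where "S = {x. airy_op a f x \<noteq> 0} \<inter> {..<a}"
  have "open S" unfolding S_def
    by (intro open_Int open_lessThan open_Collect_neq cont continuous_on_const)
  \<comment> \<open>Continuity makes S open, and an open null set is empty: the vanishing almost
    everywhere becomes vanishing at every point left of a, which the identity theorem can
    use.\<close>
  have "S \<in> null_sets lborel"
    using zero AE_iff_null_sets[of S lborel] \<open>open S\<close> by (auto simp: S_def elim!: eventually_mono)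
  then have "negligible S" unfolding negligible_iff_null_sets by (rule null_sets_completionI)
  then have "S = {}" using open_not_negligible[OF \<open>open S\<close>] by blast
  then have Z: "airy_op a f x = 0" if "x < a" for x using that by (auto simp: S_def)
  have "airy_op_entire a f (of_real x) = 0"
  proof (rule analytic_continuation[OF hol open_UNIV connected_UNIV, of "of_real ` {..<a}" "of_real a"])
    show "complex_of_real a islimpt of_real ` {..<a}"
      unfolding islimpt_approachable
    proof (intro allI impI)
      fix e :: real assume "e > 0"
      show "\<exists>x'\<in>of_real ` {..<a}. x' \<noteq> complex_of_real a \<and> dist x' (of_real a) < e"
      proof (intro bexI conjI)
        show "complex_of_real (a - e / 2) \<in> of_real ` {..<a}" using \<open>e > 0\<close> by (intro imageI) simp
        show "complex_of_real (a - e / 2) \<noteq> of_real a" using \<open>e > 0\<close> by simp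
        show "dist (complex_of_real (a - e / 2)) (of_real a) < e"
          unfolding dist_of_real using \<open>e > 0\<close> by (simp add: dist_real_def)
      qed
    qed
  qed (use Z airy_op_entire_real[OF f supp] in auto)
  then show ?thesis by (simp add: real)
qed

text \<open>From H^2 f = f and self-adjointness ||H f|| = ||f||. The transform on the whole line has
  norm at most ||f||, so nothing is left for the part below a. Once the transform is known to
  vanish, \<open>H f\<close> is zero and the equation itself returns f = 0.\<close>

lemma airy_H_injective:
  assumes f: "f \<in> L2_space (halfline a)" and eq: "AE x in halfline a. airy.H a (airy.H a f) x = f x"
  shows "AE x in halfline a. f x = 0"
proof -
  define F where "F = extend_zero a f"
  have F: "F \<in> L2_space lborel" unfolding F_def by (rule extend_zero_L2[OF f])
  have F0: "\<forall>y \<le> a. F y = 0" by (simp add: F_def)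
  note [measurable] = L2_measurable[OF f]
  have [measurable]: "F \<in> borel_measurable borel" using L2_measurable[OF F] by simp
  have "(L2_norm_on (halfline a) (airy.H a f))\<^sup>2 = (\<integral>x. f x * airy.H a (airy.H a f) x \<partial>halfline a)"
    using airy.H_self_adjoint[OF f airy.H_L2[OF f]] by (simp add: L2_norm_on_square flip: power2_eq_square)
  also have "\<dots> = (\<integral>x. f x * f x \<partial>halfline a)"
    by (rule integral_cong_AE) (use eq in auto)
  also have "\<dots> = (L2_norm_on (halfline a) f)\<^sup>2"
    by (simp add: L2_norm_on_square flip: power2_eq_square)
  finally have norm_eq: "ennreal ((L2_norm_on (halfline a) f)\<^sup>2) =
      (\<integral>\<^sup>+x. ennreal ((airy_op a F x)\<^sup>2) * indicator {a<..} x \<partial>lborel)"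
    using airy_H_square[OF f] by (simp add: F_def)
  have "(\<integral>\<^sup>+x. ennreal ((airy_op a F x)\<^sup>2) * indicator {a<..} x \<partial>lborel) +
      (\<integral>\<^sup>+x. ennreal ((airy_op a F x)\<^sup>2) * indicator {..a} x \<partial>lborel) =
      (\<integral>\<^sup>+x. ennreal ((airy_op a F x)\<^sup>2) * indicator {a<..} x + ennreal ((airy_op a F x)\<^sup>2) * indicator {..a} x \<partial>lborel)"
    by (rule nn_integral_add[symmetric]) measurable
  also have "\<dots> = (\<integral>\<^sup>+x. ennreal ((airy_op a F x)\<^sup>2) \<partial>lborel)"
    by (rule nn_integral_cong) (auto simp: indicator_def)
  also have "\<dots> \<le> ennreal ((L2_norm_on (halfline a) f)\<^sup>2)"
    using airy_op_contraction[OF F F0] by (simp add: F_def extend_zero_norm)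
  finally have "ennreal ((L2_norm_on (halfline a) f)\<^sup>2) + (\<integral>\<^sup>+x. ennreal ((airy_op a F x)\<^sup>2) * indicator {..a} x \<partial>lborel)
      \<le> ennreal ((L2_norm_on (halfline a) f)\<^sup>2) + 0"
    unfolding norm_eq by simp
  then have "(\<integral>\<^sup>+x. ennreal ((airy_op a F x)\<^sup>2) * indicator {..a} x \<partial>lborel) \<le> 0"
    by (subst (asm) ennreal_add_left_cancel_le) auto
  then have "AE x in lborel. ennreal ((airy_op a F x)\<^sup>2) * indicator {..a} x = 0"
    by (subst (asm) le_zero_eq, subst (asm) nn_integral_0_iff_AE) auto
  then have "AE x in lborel. x < a \<longrightarrow> airy_op a F x = 0"
    by eventually_elim (auto simp: indicator_def)
  then have zero: "airy_op a F x = 0" for x by (rule airy_op_vanishes[OF F F0])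
  then have "airy.H a f = (\<lambda>_. 0)" by (simp add: fun_eq_iff airy_H_eq F_def)
  then have "airy.H a (airy.H a f) x = 0" for x by (simp add: airy.H_def)
  then show ?thesis using eq by auto
qed

text \<open>Montel's theorem for the entire extensions; the limit is restricted to real arguments.
  Pointwise convergence is the form of compactness that \<open>contraction_gap\<close>
  takes.\<close>

lemma airy_H_compact:
  fixes F :: "nat \<Rightarrow> real \<Rightarrow> real"
  assumes F: "\<And>n. F n \<in> L2_space (halfline a)" and F1: "\<And>n. L2_norm_on (halfline a) (F n) \<le> 1"
  shows "\<exists>(r :: nat \<Rightarrow> nat) h. strict_mono r \<and>
    (\<forall>x \<in> space (halfline a). (\<lambda>n. airy.H a (F (r n)) x) \<longlonglongrightarrow> h x)"
proof -
  define \<H> where "\<H> = {airy_op_entire a f | f. f \<in> L2_space lborel \<and> (\<forall>y \<le> a. f y = 0) \<and> L2_norm_on lborel f \<le> 1}"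
  define E where "E n = airy_op_entire a (extend_zero a (F n))" for n
  have E: "E n \<in> \<H>" for n
    unfolding E_def \<H>_def using extend_zero_L2[OF F] F1 by (force simp: extend_zero_norm)
  obtain g r where r: "strict_mono r" and g: "\<And>z. (\<lambda>n. E (r n) z) \<longlonglongrightarrow> g z"
  proof (rule Montel[OF open_UNIV, of \<H> E])
    show "h holomorphic_on UNIV" if "h \<in> \<H>" for h
      using that airy_op_entire_holomorphic by (auto simp: \<H>_def)
    show "\<exists>B. \<forall>h \<in> \<H>. \<forall>z \<in> K. norm (h z) \<le> B" if "compact K" for K
    proof -
      obtain \<rho> where \<rho>: "\<And>z. z \<in> K \<Longrightarrow> cmod z \<le> \<rho>"
        using compact_imp_bounded[OF \<open>compact K\<close>] unfolding bounded_iff by blast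
      obtain B where B: "B \<ge> 0" "\<And>f z. f \<in> L2_space lborel \<Longrightarrow> \<forall>y \<le> a. f y = 0 \<Longrightarrow> cmod z \<le> \<rho> \<Longrightarrow>
          cmod (airy_op_entire a f z) \<le> B * L2_norm_on lborel f"
        using airy_op_entire_locally_bounded[of a \<rho>] by blast
      have "norm (h z) \<le> B" if "h \<in> \<H>" "z \<in> K" for h z
      proof -
        obtain f where f: "h = airy_op_entire a f" "f \<in> L2_space lborel" "\<forall>y \<le> a. f y = 0" "L2_norm_on lborel f \<le> 1"
          using \<open>h \<in> \<H>\<close> by (auto simp: \<H>_def)
        have "norm (h z) \<le> B * L2_norm_on lborel f" unfolding f(1) by (rule B(2)[OF f(2,3) \<rho>[OF \<open>z \<in> K\<close>]])
        also have "\<dots> \<le> B" using mult_left_mono[OF f(4) B(1)] by simp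
        finally show ?thesis .
      qed
      then show ?thesis by blast
    qed
    show "range E \<subseteq> \<H>" using E by blast
  qed (use that in auto)
  have "(\<lambda>n. airy.H a (F (r n)) x) \<longlonglongrightarrow> Re (g (of_real x))" for x
    using tendsto_Re[OF g[of "of_real x"]]
    by (simp add: E_def airy_op_entire_real[OF extend_zero_L2[OF F] extend_zero_vanishes] airy_H_eq)
  with r show ?thesis
    by (intro exI[of _ r] exI[of _ "\<lambda>x. Re (g (of_real x))"]) simp
qed

interpretation airy: contractive_hilbert_schmidt "halfline a" "\<lambda>x y. Airy (x + y - a)" for a
  by unfold_locales
    (rule airy.contraction_gap[OF airy_H_contraction airy_H_injective airy_H_compact])

section \<open>The tacnode kernel\<close>

lemma halfline_substitution:
  fixes g :: "real \<Rightarrow> real"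
  assumes "c > 0"
  shows "(LBINT u:{0<..}. g u) = c * (\<integral>y. g (c * (y - a)) \<partial>halfline a)"
proof -
  have "(LBINT u:{0<..}. g u) = \<bar>c\<bar> *\<^sub>R (LBINT y. indicator {0<..} (- c * a + c * y) *\<^sub>R g (- c * a + c * y))"
    unfolding set_lebesgue_integral_def by (rule lborel_integral_real_affine) (use assms in simp)
  also have "(\<lambda>y. indicator {0<..} (- c * a + c * y) *\<^sub>R g (- c * a + c * y)) =
      (\<lambda>y. indicator {a<..} y *\<^sub>R g (c * (y - a)))"
    using assms by (auto simp: fun_eq_iff indicator_def algebra_simps)
  finally show ?thesis using assms by (simp add: integral_halfline set_lebesgue_integral_def)
qed

lemma Airy_ext_0 [simp]: "Airy_ext 0 x = Airy x"
  by (simp add: Airy_ext_def)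

text \<open>The left side does not involve a: substituting z = u + a factors the same kernel through
  any half-line, so a can be matched to the cut-off.\<close>

lemma K_Airy_kernel:
  "K_Airy x y = (\<integral>z. Airy (x + z - a) * Airy (z + y - a) \<partial>halfline a)"
proof -
  have "K_Airy x y = (LBINT u:{0<..}. Airy (x + u) * Airy (y + u))"
    by (simp add: K_Airy_def K_Airy_ext_def)
  also have "\<dots> = 1 * (\<integral>z. Airy (x + 1 * (z - a)) * Airy (y + 1 * (z - a)) \<partial>halfline a)"
    by (rule halfline_substitution) simp
  finally show ?thesis by (simp add: algebra_simps)
qed

lemma K_Airy_op_eq:
  assumes "g \<in> L2_space (halfline a)" "x > a"
  shows "K_Airy_op a g x = airy.H a (airy.H a g) x"
  using airy.H_H_kernel[OF assms(1), of x] assms(2)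
  by (simp add: K_Airy_op_def K_Airy_kernel[of _ _ a] integral_halfline space_restrict_space)

lemma Airy_resolvent_solves:
  assumes f: "f \<in> L2_space (halfline a)"
  shows "airy.solves a (Airy_resolvent a f) f"
proof -
  have iff: "airy.solves a g f \<longleftrightarrow>
      g \<in> L2_halfline a \<and> (AE x in lborel. x > a \<longrightarrow> g x - K_Airy_op a g x = f x)" for g
  proof (cases "g \<in> L2_space (halfline a)")
    case True
    have "(AE x in halfline a. g x - airy.H a (airy.H a g) x = f x) \<longleftrightarrow>
        (AE x in lborel. x \<in> {a<..} \<longrightarrow> g x - airy.H a (airy.H a g) x = f x)"
      by (rule AE_restrict_space_iff) simp
    also have "\<dots> \<longleftrightarrow> (AE x in lborel. x > a \<longrightarrow> g x - K_Airy_op a g x = f x)"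
      using K_Airy_op_eq[OF True] by (intro AE_cong) auto
    finally show ?thesis using True by (simp add: airy.solves_def L2_halfline_eq)
  qed (simp add: airy.solves_def L2_halfline_eq)
  show ?thesis
    using someI_ex[OF airy.solves_exists[OF f]] unfolding iff Airy_resolvent_def .
qed

lemma Airy_ext_measurable [measurable]: "Airy_ext s \<in> borel_measurable borel"
  unfolding Airy_ext_def by measurable

lemma Airy_ext_L2:
  assumes q: "q > 0"
  shows "(\<lambda>x. Airy_ext s (p + q * x)) \<in> L2_space (halfline a)"
proof -
  \<comment> \<open>Any rate above s would do to beat the factor exp(x s) of
    \<open>Airy_ext\<close>; D below is the value of the resulting exponential at x = a.\<close>
  define \<eta> where "\<eta> = \<bar>s\<bar> + 1"
  have e: "\<eta> > 0" and es: "\<eta> - s > 0" by (auto simp: \<eta>_def)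
  define C where "C = (LBINT t. cmod (airy_symbol \<eta> t)) / (2 * pi)"
  define D where "D = exp (2 / 3 * s ^ 3 - \<eta> * s\<^sup>2 - (\<eta> - s) * (p + q * a))"
  show ?thesis
  proof (rule L2_halflineI[where C = "C * D" and \<eta> = "(\<eta> - s) * q"])
    show "(\<eta> - s) * q > 0" using es q by simp
    fix x
    have "\<bar>Airy (s\<^sup>2 + (p + q * x))\<bar> \<le> C * exp (- \<eta> * (s\<^sup>2 + (p + q * x)))"
      unfolding C_def by (rule Airy_bound[OF e])
    then have "exp (2 / 3 * s ^ 3 + (p + q * x) * s) * \<bar>Airy (s\<^sup>2 + (p + q * x))\<bar> \<le>
        exp (2 / 3 * s ^ 3 + (p + q * x) * s) * (C * exp (- \<eta> * (s\<^sup>2 + (p + q * x))))"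
      by (rule mult_left_mono) simp
    also have "\<dots> = C * (exp (2 / 3 * s ^ 3 + (p + q * x) * s) * exp (- \<eta> * (s\<^sup>2 + (p + q * x))))"
      by (simp only: mult_ac)
    also have "exp (2 / 3 * s ^ 3 + (p + q * x) * s) * exp (- \<eta> * (s\<^sup>2 + (p + q * x))) =
        D * exp (- ((\<eta> - s) * q) * (x - a))"
      unfolding D_def exp_add[symmetric] by (rule arg_cong[where f = exp]) (simp add: algebra_simps)
    finally show "\<bar>Airy_ext s (p + q * x)\<bar> \<le> C * D * exp (- ((\<eta> - s) * q) * (x - a))"
      by (simp add: Airy_ext_def abs_mult mult.assoc)
  qed measurable
qed

lemma b_fun_L2:
  assumes "l > 0"
  shows "b_fun l \<tau> \<xi> \<in> L2_space (halfline a)"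
proof -
  have "1 + sqrt l > 0" using assms by (simp add: add_pos_pos)
  then show ?thesis
    unfolding b_fun_def by (intro L2_scale Airy_ext_L2) simp
qed

text \<open>With u = l^(1/6) and v = (1 + sqrt l)^(1/3) one has sqrt l = u^3 and v^3 = 1 + u^3, and
  every fractional power in the definitions becomes rational in u and v.\<close>

lemma lambda_powers:
  assumes l: "l > 0"
  obtains u v :: real where "u > 0" "v > 0" "v ^ 3 = 1 + u ^ 3"
    "l powr (1/6) = u" "l powr (1/3) = u\<^sup>2" "l powr (2/3) = u ^ 4"
    "(1 / l) powr (1/6) = 1 / u" "(1 / l) powr (1/3) = 1 / u\<^sup>2" "(1 / l) powr (2/3) = 1 / u ^ 4"
    "(1 + sqrt l) powr (1/3) = v" "(1 + sqrt l) powr (2/3) = v\<^sup>2"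
    "(1 + sqrt (1 / l)) powr (1/3) = v / u" "(1 + sqrt (1 / l)) powr (2/3) = v\<^sup>2 / u\<^sup>2"
proof -
  define u where "u = l powr (1/6)"
  define v where "v = (1 + u ^ 3) powr (1/3)"
  have u: "u > 0" using l by (simp add: u_def)
  then have u3: "1 + u ^ 3 > 0" by (simp add: add_pos_pos)
  then have v: "v > 0" by (simp add: v_def)
  have pow: "(x powr (y :: real)) ^ n = x powr (real n * y)" if "x > 0" for x y n
    using that by (simp add: powr_powr powr_realpow[symmetric] mult.commute)
  have v3: "v ^ 3 = 1 + u ^ 3" unfolding v_def using u3 by (simp add: pow)
  have l6: "l = u ^ 6" unfolding u_def using l by (simp add: pow)
  have sq: "sqrt l = u ^ 3"
    by (rule real_sqrt_unique) (use u in \<open>simp_all add: l6 flip: power_mult\<close>)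
  have sq': "1 + sqrt (1 / l) = (1 + u ^ 3) / u ^ 3"
    using u by (simp add: real_sqrt_divide sq field_simps)
  have v2: "(1 + u ^ 3) powr (2/3) = v\<^sup>2"
    unfolding v_def using u3 by (simp add: pow)
  have "u ^ 3 = u powr 3" using u by simp
  then have u_powr: "(u ^ 3) powr (1/3) = u" "(u ^ 3) powr (2/3) = u\<^sup>2"
    using u by (simp_all only: powr_powr) simp_all
  show ?thesis
  proof (rule that[OF u v v3])
    show "l powr (1/6) = u" by (simp add: u_def)
    show "l powr (1/3) = u\<^sup>2" "l powr (2/3) = u ^ 4"
      unfolding u_def using l by (simp_all add: pow)
    then show "(1 / l) powr (1/6) = 1 / u" "(1 / l) powr (1/3) = 1 / u\<^sup>2" "(1 / l) powr (2/3) = 1 / u ^ 4"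
      using l by (simp_all add: powr_divide u_def)
    show "(1 + sqrt l) powr (1/3) = v" by (simp add: sq v_def)
    show "(1 + sqrt l) powr (2/3) = v\<^sup>2" by (simp add: sq v2)
    show "(1 + sqrt (1 / l)) powr (1/3) = v / u"
      unfolding sq' using u u3 by (simp add: powr_divide u_powr v_def)
    show "(1 + sqrt (1 / l)) powr (2/3) = v\<^sup>2 / u\<^sup>2"
      unfolding sq' using u u3 by (simp add: powr_divide u_powr v2)
  qed
qed

definition b_dual :: "real \<Rightarrow> real \<Rightarrow> real \<Rightarrow> real \<Rightarrow> real \<Rightarrow> real" where
  "b_dual l \<sigma> \<tau> \<xi> = b_fun (1 / l) (l powr (1/3) * \<tau>) (l powr (2/3) * \<sigma> + - (l powr (1/6)) * \<xi>)"

text \<open>Here the cut-off \<open>sigma_tilde\<close> earns its value u v^2 \<sigma>. The scale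
  v/u turns it into v^3 \<sigma> = (1 + u^3) \<sigma>, so \<sigma> + \<xi> becomes \<xi> - u^3
  \<sigma>, precisely the shift in the dual function.\<close>

lemma b_dual_eq:
  assumes l: "l > 0"
  shows "l powr (1/6) * b_dual l \<sigma> \<tau> \<xi> y =
    Airy_ext \<tau> (\<sigma> + \<xi> + (1 + sqrt (1 / l)) powr (1/3) * (y - sigma_tilde l \<sigma>))"
proof -
  obtain u v where uv: "u > 0" "v > 0" "v ^ 3 = 1 + u ^ 3"
    and pw: "l powr (1/6) = u" "l powr (1/3) = u\<^sup>2" "l powr (2/3) = u ^ 4"
    "(1 / l) powr (1/6) = 1 / u" "(1 / l) powr (1/3) = 1 / u\<^sup>2" "(1 / l) powr (2/3) = 1 / u ^ 4"
    "(1 + sqrt l) powr (1/3) = v" "(1 + sqrt l) powr (2/3) = v\<^sup>2"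
    "(1 + sqrt (1 / l)) powr (1/3) = v / u" "(1 + sqrt (1 / l)) powr (2/3) = v\<^sup>2 / u\<^sup>2"
    using lambda_powers[OF l] by blast
  have "v / u * (u * v\<^sup>2 * \<sigma>) = v ^ 3 * \<sigma>" using uv(1) by (simp add: power2_eq_square power3_eq_cube)
  then have "v / u * (y - u * v\<^sup>2 * \<sigma>) = v / u * y - (1 + u ^ 3) * \<sigma>"
    by (simp only: right_diff_distrib uv(3))
  moreover have "(1 / u) * (u ^ 4 * \<sigma> + - u * \<xi>) = u ^ 3 * \<sigma> - \<xi>"
    using uv(1) by (simp add: field_simps power3_eq_cube power4_eq_xxxx)
  ultimately have arg: "\<sigma> + \<xi> + v / u * (y - u * v\<^sup>2 * \<sigma>) = - (1 / u) * (u ^ 4 * \<sigma> + - u * \<xi>) + v / u * y"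
    by (simp add: algebra_simps)
  have \<tau>: "1 / u\<^sup>2 * (u\<^sup>2 * \<tau>) = \<tau>" using uv(1) by simp
  show ?thesis
    unfolding b_dual_def b_fun_def sigma_tilde_def pw arg \<tau> using uv(1) by simp
qed

lemma B_fun_eq:
  assumes l: "l > 0"
  shows "B_fun l \<tau> (\<sigma> + \<xi>) x = l powr (1/6) * airy.H (sigma_tilde l \<sigma>) (b_dual l \<sigma> \<tau> \<xi>) x"
proof -
  define a where "a = sigma_tilde l \<sigma>"
  define c where "c = (1 + sqrt (1 / l)) powr (1/3)"
  have "B_fun l \<tau> (\<sigma> + \<xi>) x = (LBINT \<mu>:{0<..}. Airy_ext \<tau> (\<sigma> + \<xi> + c * \<mu>) * Airy (x + \<mu>))"
    by (simp add: B_fun_def c_def)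
  also have "\<dots> = 1 * (\<integral>y. Airy_ext \<tau> (\<sigma> + \<xi> + c * (1 * (y - a))) * Airy (x + 1 * (y - a)) \<partial>halfline a)"
    by (rule halfline_substitution) simp
  also have "\<dots> = (\<integral>y. l powr (1/6) * (Airy (x + y - a) * b_dual l \<sigma> \<tau> \<xi> y) \<partial>halfline a)"
    using b_dual_eq[OF l, of \<sigma> \<tau> \<xi>, folded a_def c_def, symmetric]
    by (simp add: add_diff_eq mult_ac)
  finally show ?thesis by (simp add: airy.H_def a_def)
qed

text \<open>The first factor is the Jacobian of the substitution, and l^(1/3) collects the factor
  l^(1/6) of each of the two functions.\<close>

lemma K_Airy_ext_eq:
  assumes l: "l > 0"
  shows "K_Airy_ext \<alpha> \<beta> (\<sigma> + \<xi>1) (\<sigma> + \<xi>2) =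
    (1 + sqrt (1 / l)) powr (1/3) * l powr (1/3) *
      (\<integral>y. b_dual l \<sigma> \<alpha> \<xi>1 y * b_dual l \<sigma> \<beta> \<xi>2 y \<partial>halfline (sigma_tilde l \<sigma>))"
proof -
  define a where "a = sigma_tilde l \<sigma>"
  define c where "c = (1 + sqrt (1 / l)) powr (1/3)"
  have "1 + sqrt (1 / l) > 0" using l by (simp add: add_pos_pos)
  then have c: "c > 0" by (simp add: c_def)
  have l3: "l powr (1/6) * l powr (1/6) = l powr (1/3)" by (simp flip: powr_add)
  have "K_Airy_ext \<alpha> \<beta> (\<sigma> + \<xi>1) (\<sigma> + \<xi>2) =
      c * (\<integral>y. Airy_ext \<alpha> (\<sigma> + \<xi>1 + c * (y - a)) * Airy_ext \<beta> (\<sigma> + \<xi>2 + c * (y - a)) \<partial>halfline a)"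
    unfolding K_Airy_ext_def by (rule halfline_substitution[OF c])
  also have "\<dots> = c * (\<integral>y. (l powr (1/6) * b_dual l \<sigma> \<alpha> \<xi>1 y) * (l powr (1/6) * b_dual l \<sigma> \<beta> \<xi>2 y) \<partial>halfline a)"
    unfolding b_dual_eq[OF l, of \<sigma>, folded a_def c_def] by (rule refl)
  also have "\<dots> = c * (\<integral>y. l powr (1/3) * (b_dual l \<sigma> \<alpha> \<xi>1 y * b_dual l \<sigma> \<beta> \<xi>2 y) \<partial>halfline a)"
    unfolding l3[symmetric] by (simp only: mult_ac)
  finally show ?thesis by (simp add: a_def c_def)
qed

lemma b_dual_L2: "l > 0 \<Longrightarrow> b_dual l \<sigma> \<tau> \<xi> \<in> L2_space (halfline a)"
  unfolding b_dual_def by (rule b_fun_L2) simp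

text \<open>Duality is an involution, so the summand with parameter 1/l is built from the same four
  functions with roles exchanged.\<close>

lemma b_dual_dual:
  assumes l: "l > 0"
  shows "b_dual (1 / l) (l powr (2/3) * \<sigma>) (l powr (1/3) * \<tau>) (- (l powr (1/6)) * \<xi>) = b_fun l \<tau> (\<sigma> + \<xi>)"
proof -
  obtain u v where "u > 0"
    and pw: "l powr (1/6) = u" "l powr (1/3) = u\<^sup>2" "l powr (2/3) = u ^ 4"
    "(1 / l) powr (1/6) = 1 / u" "(1 / l) powr (1/3) = 1 / u\<^sup>2" "(1 / l) powr (2/3) = 1 / u ^ 4"
    using lambda_powers[OF l] by blast
  then show ?thesis unfolding b_dual_def pw by simp
qed

text \<open>In terms of u and v: (1/u)(v^2/u^2) u^4 = u v^2. Both summands therefore use one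
  half-line and one operator \<open>H\<close>.\<close>

lemma sigma_tilde_dual:
  assumes l: "l > 0"
  shows "sigma_tilde (1 / l) (l powr (2/3) * \<sigma>) = sigma_tilde l \<sigma>"
proof -
  obtain u v where "u > 0"
    and pw: "l powr (1/6) = u" "l powr (2/3) = u ^ 4" "(1 / l) powr (1/6) = 1 / u"
     "(1 + sqrt l) powr (2/3) = v\<^sup>2" "(1 + sqrt (1 / l)) powr (2/3) = v\<^sup>2 / u\<^sup>2"
    using lambda_powers[OF l] by blast
  then show ?thesis unfolding sigma_tilde_def pw by (simp add: field_simps power2_eq_square power4_eq_xxxx)
qed

lemma L_tac_eq:
  fixes l \<sigma> \<tau>1 \<xi>1 \<tau>2 \<xi>2 :: real
  assumes l: "l > 0"
  defines "a \<equiv> sigma_tilde l \<sigma>" and "c \<equiv> (1 + sqrt (1 / l)) powr (1/3)"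
    and "r \<equiv> Airy_resolvent (sigma_tilde l \<sigma>) (b_dual l \<sigma> (- \<tau>1) \<xi>1)"
  shows "L_tac l \<sigma> \<tau>1 \<xi>1 \<tau>2 \<xi>2 =
      c * l powr (1/3) * (\<integral>x. b_dual l \<sigma> \<tau>2 \<xi>2 x * r x \<partial>halfline a)
      - c * l powr (1/6) * (\<integral>x. b_fun l \<tau>2 (\<sigma> + \<xi>2) x * airy.H a r x \<partial>halfline a)"
    and "L_tac_tilde l \<sigma> \<tau>1 \<xi>1 \<tau>2 \<xi>2 =
      c * (\<integral>x. b_fun l \<tau>2 (\<sigma> + \<xi>2) x * Airy_resolvent a (b_fun l (- \<tau>1) (\<sigma> + \<xi>1)) x \<partial>halfline a)
      - c * l powr (1/6) * (\<integral>x. b_fun l \<tau>2 (\<sigma> + \<xi>2) x * airy.H a r x \<partial>halfline a)"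
proof -
  define u where "u = l powr (1/6)"
  define d1 where "d1 = b_dual l \<sigma> (- \<tau>1) \<xi>1"
  define d2 where "d2 = b_dual l \<sigma> \<tau>2 \<xi>2"
  define b1 where "b1 = b_fun l (- \<tau>1) (\<sigma> + \<xi>1)"
  define b2 where "b2 = b_fun l \<tau>2 (\<sigma> + \<xi>2)"
  have u2: "u * u = l powr (1/3)" by (simp add: u_def flip: powr_add)
  have L2: "d1 \<in> L2_space (halfline a)" "d2 \<in> L2_space (halfline a)"
      "b1 \<in> L2_space (halfline a)" "b2 \<in> L2_space (halfline a)"
    using l by (auto simp: d1_def d2_def b1_def b2_def b_dual_L2 b_fun_L2)
  have r: "airy.solves a r d1" unfolding r_def d1_def a_def[symmetric]
    by (rule Airy_resolvent_solves[OF L2(1)[unfolded d1_def]])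
  have rL: "r \<in> L2_space (halfline a)" using r by (simp add: airy.solves_def)
  note Hr = airy.H_L2[OF rL] and Hd1 = airy.H_L2[OF L2(1)] and Hd2 = airy.H_L2[OF L2(2)]
  have Hsol: "airy.solves a (\<lambda>x. u * airy.H a r x) (\<lambda>x. u * airy.H a d1 x)"
    by (intro airy.solves_scale airy.solves_H[OF r L2(1)])
  have B1: "B_fun l (- \<tau>1) (\<sigma> + \<xi>1) = (\<lambda>x. u * airy.H a d1 x)"
    by (simp add: B_fun_eq[OF l] u_def d1_def a_def fun_eq_iff)
  have B2: "B_fun l \<tau>2 (\<sigma> + \<xi>2) = (\<lambda>x. u * airy.H a d2 x)"
    by (simp add: B_fun_eq[OF l] u_def d2_def a_def fun_eq_iff)
  have B2L: "(\<lambda>x. u * airy.H a d2 x) \<in> L2_space (halfline a)" by (rule L2_scale[OF Hd2])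
  have "L2_inner a (\<lambda>x. u * airy.H a d2 x - b2 x) (Airy_resolvent a (\<lambda>x. u * airy.H a d1 x)) =
      (\<integral>x. (u * airy.H a d2 x - b2 x) * Airy_resolvent a (\<lambda>x. u * airy.H a d1 x) x \<partial>halfline a)"
    by (simp add: L2_inner_def integral_halfline)
  also have "\<dots> = (\<integral>x. (u * airy.H a d2 x - b2 x) * (u * airy.H a r x) \<partial>halfline a)"
    by (rule airy.integral_solves_cong[OF Airy_resolvent_solves[OF L2_scale[OF Hd1]] Hsol
          L2_measurable[OF L2_diff[OF B2L L2(4)]]])
  also have "\<dots> = (\<integral>x. (u * u) * (airy.H a d2 x * airy.H a r x) - u * (b2 x * airy.H a r x) \<partial>halfline a)"
    by (simp add: algebra_simps)
  also have "\<dots> = (u * u) * (\<integral>x. airy.H a d2 x * airy.H a r x \<partial>halfline a) - u * (\<integral>x. b2 x * airy.H a r x \<partial>halfline a)"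
    using L2_mult_integrable[OF Hd2 Hr] L2_mult_integrable[OF L2(4) Hr] by simp
  \<comment> \<open>The term <d1, d2> split off here has the same coefficient as the extended Airy
    kernel, with opposite sign, and removes it below.\<close>
  also have "(\<integral>x. airy.H a d2 x * airy.H a r x \<partial>halfline a) =
      (\<integral>x. d2 x * r x \<partial>halfline a) - (\<integral>x. d1 x * d2 x \<partial>halfline a)"
    by (rule airy.integral_H_solution[OF L2(1,2) r])
  finally have inner: "L2_inner a (\<lambda>x. u * airy.H a d2 x - b2 x) (Airy_resolvent a (\<lambda>x. u * airy.H a d1 x)) =
      (u * u) * ((\<integral>x. d2 x * r x \<partial>halfline a) - (\<integral>x. d1 x * d2 x \<partial>halfline a))
      - u * (\<integral>x. b2 x * airy.H a r x \<partial>halfline a)" .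
  have "L_tac l \<sigma> \<tau>1 \<xi>1 \<tau>2 \<xi>2 = c * (u * u) * (\<integral>x. d1 x * d2 x \<partial>halfline a) +
      c * L2_inner a (\<lambda>x. u * airy.H a d2 x - b2 x) (Airy_resolvent a (\<lambda>x. u * airy.H a d1 x))"
    unfolding L_tac_def K_Airy_ext_eq[OF l] B1 B2 u2 by (simp add: a_def c_def d1_def d2_def b2_def)
  also have "\<dots> = c * (u * u) * (\<integral>x. d2 x * r x \<partial>halfline a) - c * u * (\<integral>x. b2 x * airy.H a r x \<partial>halfline a)"
    unfolding inner by (simp add: algebra_simps)
  finally show "L_tac l \<sigma> \<tau>1 \<xi>1 \<tau>2 \<xi>2 =
      c * l powr (1/3) * (\<integral>x. b_dual l \<sigma> \<tau>2 \<xi>2 x * r x \<partial>halfline a)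
      - c * l powr (1/6) * (\<integral>x. b_fun l \<tau>2 (\<sigma> + \<xi>2) x * airy.H a r x \<partial>halfline a)"
    by (simp only: u2[unfolded u_def] u_def d2_def b2_def)
  define s where "s = Airy_resolvent a b1"
  have s: "airy.solves a s b1" unfolding s_def by (rule Airy_resolvent_solves[OF L2(3)])
  have sL: "s \<in> L2_space (halfline a)" using s by (simp add: airy.solves_def)
  have C1: "C_fun l (- \<tau>1) (\<sigma> + \<xi>1) = (\<lambda>x. b1 x + (-1) * (u * airy.H a d1 x))"
    unfolding C_fun_def B1 by (simp add: b1_def)
  have C1L: "(\<lambda>x. b1 x + (-1) * (u * airy.H a d1 x)) \<in> L2_space (halfline a)"
    by (intro L2_add L2_scale L2 Hd1)
  have "L_tac_tilde l \<sigma> \<tau>1 \<xi>1 \<tau>2 \<xi>2 =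
      c * (\<integral>x. b2 x * Airy_resolvent a (\<lambda>x. b1 x + (-1) * (u * airy.H a d1 x)) x \<partial>halfline a)"
    unfolding L_tac_tilde_def C1 integral_halfline by (simp add: a_def c_def b2_def mult.commute)
  \<comment> \<open>The solution for C = b - B is assembled from those for its two parts; the part
    for B is \<open>u * airy.H a r\<close> as in the first claim, so the cross terms
    coincide.\<close>
  also have "(\<integral>x. b2 x * Airy_resolvent a (\<lambda>x. b1 x + (-1) * (u * airy.H a d1 x)) x \<partial>halfline a) =
      (\<integral>x. b2 x * (s x + (-1) * (u * airy.H a r x)) \<partial>halfline a)"
    by (rule airy.integral_solves_cong[OF Airy_resolvent_solves[OF C1L] airy.solves_combine[OF s Hsol]
          L2_measurable[OF L2(4)]])
  also have "\<dots> = (\<integral>x. b2 x * s x - u * (b2 x * airy.H a r x) \<partial>halfline a)"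
    by (simp add: algebra_simps)
  also have "\<dots> = (\<integral>x. b2 x * s x \<partial>halfline a) - u * (\<integral>x. b2 x * airy.H a r x \<partial>halfline a)"
    using L2_mult_integrable[OF L2(4) sL] L2_mult_integrable[OF L2(4) Hr] by simp
  finally show "L_tac_tilde l \<sigma> \<tau>1 \<xi>1 \<tau>2 \<xi>2 =
      c * (\<integral>x. b_fun l \<tau>2 (\<sigma> + \<xi>2) x * Airy_resolvent a (b_fun l (- \<tau>1) (\<sigma> + \<xi>1)) x \<partial>halfline a)
      - c * l powr (1/6) * (\<integral>x. b_fun l \<tau>2 (\<sigma> + \<xi>2) x * airy.H a r x \<partial>halfline a)"
    by (simp add: right_diff_distrib mult.assoc s_def u_def b1_def b2_def)
qed

theorem proposition1p2:
  fixes l \<sigma> \<tau>1 \<xi>1 \<tau>2 \<xi>2 :: real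
  assumes "l > 0"
  shows "tacnode_kernel l \<sigma> \<tau>1 \<xi>1 \<tau>2 \<xi>2 =
     - of_bool (\<tau>1 < \<tau>2) * heat_kernel (\<tau>2 - \<tau>1) \<xi>1 \<xi>2
     + L_tac_tilde l \<sigma> \<tau>1 \<xi>1 \<tau>2 \<xi>2
     + l powr (1/6) *
       L_tac_tilde (1 / l) (l powr (2/3) * \<sigma>)
         (l powr (1/3) * \<tau>1) (- (l powr (1/6)) * \<xi>1)
         (l powr (1/3) * \<tau>2) (- (l powr (1/6)) * \<xi>2)"
proof -
  obtain u v where u: "u > 0"
    and pw: "l powr (1/6) = u" "l powr (1/3) = u\<^sup>2"
    "(1 / l) powr (1/6) = 1 / u" "(1 / l) powr (1/3) = 1 / u\<^sup>2"
    "(1 + sqrt l) powr (1/3) = v" "(1 + sqrt (1 / l)) powr (1/3) = v / u"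
    using lambda_powers[OF assms] by blast
  define a where "a = sigma_tilde l \<sigma>"
  define b1 where "b1 = b_fun l (- \<tau>1) (\<sigma> + \<xi>1)"
  define b2 where "b2 = b_fun l \<tau>2 (\<sigma> + \<xi>2)"
  define d1 where "d1 = b_dual l \<sigma> (- \<tau>1) \<xi>1"
  define d2 where "d2 = b_dual l \<sigma> \<tau>2 \<xi>2"
  define pair where "pair f g = (\<integral>x. f x * Airy_resolvent a g x \<partial>halfline a)" for f g
  define pairH where "pairH f g = (\<integral>x. f x * airy.H a (Airy_resolvent a g) x \<partial>halfline a)" for f g
  have L: "L_tac l \<sigma> \<tau>1 \<xi>1 \<tau>2 \<xi>2 = v / u * u\<^sup>2 * pair d2 d1 - v / u * u * pairH b2 d1"
    "L_tac_tilde l \<sigma> \<tau>1 \<xi>1 \<tau>2 \<xi>2 = v / u * pair b2 b1 - v / u * u * pairH b2 d1"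
    unfolding L_tac_eq[OF assms] pw pair_def pairH_def a_def b1_def b2_def d1_def d2_def by (rule refl)+
  define l' where "l' = 1 / l"
  have "l' > 0" and inv: "1 / l' = l" using assms by (auto simp: l'_def)
  have dual: "b_fun l' (l powr (1/3) * - \<tau>1) (l powr (2/3) * \<sigma> + - (l powr (1/6)) * \<xi>1) = d1"
    "b_fun l' (l powr (1/3) * \<tau>2) (l powr (2/3) * \<sigma> + - (l powr (1/6)) * \<xi>2) = d2"
    by (simp_all only: d1_def d2_def b_dual_def l'_def)
  have dual': "b_dual l' (l powr (2/3) * \<sigma>) (l powr (1/3) * - \<tau>1) (- (l powr (1/6)) * \<xi>1) = b1"
    "b_dual l' (l powr (2/3) * \<sigma>) (l powr (1/3) * \<tau>2) (- (l powr (1/6)) * \<xi>2) = b2"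
    "sigma_tilde l' (l powr (2/3) * \<sigma>) = a"
    by (simp_all only: b_dual_dual[OF assms] sigma_tilde_dual[OF assms] b1_def b2_def a_def l'_def)
  have L': "L_tac l' (l powr (2/3) * \<sigma>) (l powr (1/3) * \<tau>1) (- (l powr (1/6)) * \<xi>1)
      (l powr (1/3) * \<tau>2) (- (l powr (1/6)) * \<xi>2) =
      v * (1 / u\<^sup>2) * pair b2 b1 - v * (1 / u) * pairH d2 b1"
    "L_tac_tilde l' (l powr (2/3) * \<sigma>) (l powr (1/3) * \<tau>1) (- (l powr (1/6)) * \<xi>1)
      (l powr (1/3) * \<tau>2) (- (l powr (1/6)) * \<xi>2) =
      v * pair d2 d1 - v * (1 / u) * pairH d2 b1"
    \<comment> \<open>Rewriting with \<open>mult_minus_right\<close> moves the sign of the first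
      time inside the product, so that the dual functions are recognised at
      \<open>- \<tau>1\<close>.\<close>
    unfolding L_tac_eq[OF \<open>l' > 0\<close>] mult_minus_right[symmetric] dual dual' inv pair_def pairH_def
    unfolding l'_def pw by (rule refl)+
  show ?thesis
    unfolding tacnode_kernel_def L
    unfolding L'[unfolded l'_def]
    unfolding pw
    \<comment> \<open>After multiplication by u the dual diagonal coefficients v/u^2 and v become
      v/u and u v, the values that complete the exchange.\<close>
    using u by (simp add: field_simps power2_eq_square)
qed

end
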